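(* Let $(X_\Delta,L_\Delta)$ be an $n$-dimensional toric Fano manifold with anticanonical polarization $L_\Delta=-K_{X_\Delta}$ and moment polytope $\Delta\subset\mathbb{R}^n$, and write $\theta_\Delta=\sum_{i=1}^n a_ix_i+c$ with $a_i,c\in\mathbb{R}$. Let $\Delta^-=\{x\in\Delta : 1-\theta_\Delta(x)<0\}$. (1) If $\mathrm{Int}(\Delta^-)=\emptyset$, i.e. $\theta_\Delta\le 1$ on $\Delta$, then $(X_\Delta,L_\Delta)$ is relatively strongly $K$-stable in the toric sense. (2) If $\mathrm{Int}(\Delta^-)\neq\emptyset$ and $$1-c<\frac{\int_{\Delta^-}(1-\theta_\Delta)^2\,dx}{\mathrm{Vol}(\Delta^-)},$$ then there exists a simple piecewise linear function $u$ such that $\mathcal{L}_\Delta(u)<0$.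
   Context: The moment polytope of an anticanonically polarized toric Fano manifold is $\Delta=\{x\in\mathbb{R}^n:\langle l_j,x\rangle\le 1,\ j=1,\dots,d\}$, where the $l_j\in\mathbb{Z}^n$ are primitive, $\Delta$ is an $n$-dimensional lattice polytope (so the origin is interior), each $\langle l_j,x\rangle=1$ defines a facet, and Delzant's condition holds (exactly $n$ facets meet at each vertex and their normals $l_j$ form a $\mathbb{Z}$-basis of $\mathbb{Z}^n$). $\mathrm{Vol}$ and $dx$ refer to Lebesgue measure; $d\sigma=|l_j|^{-1}d\sigma_0$ on the facet with normal $l_j$, where $d\sigma_0$ is the standard Lebesgue (surface) measure on $\partial\Delta$. Put $\mathrm{Vol}(\partial\Delta)=\int_{\partial\Delta}d\sigma$ and $\bar S=\mathrm{Vol}(\partial\Delta)/\mathrm{Vol}(\Delta)$ (here $\bar S=n$), and $$\mathcal{L}_\Delta(u)=\int_{\partial\Delta}u\,d\sigma-\int_\Delta(\bar S+\theta_\Delta)u\,dx .$$ The function $\theta_\Delta$ (potential of the extremal vector field) is the unique affine linear function on $\mathbb{R}^n$ such that $\mathcal{L}_\Delta(u)=0$ for every affine linear $u$; in particular $\int_\Delta\theta_\Delta\,dx=0$. Let $\Delta^*$ be the union of the interior of $\Delta$ and the interiors of its codimension-one faces, and let $\mathcal{C}_1$ be the set of functions $u$ convex on $\Delta^*$ with $\int_{\partial\Delta}u\,d\sigma<\infty$. $(X_\Delta,L_\Delta)$ is relatively strongly $K$-stable in the toric sense if $\mathcal{L}_\Delta(u)\ge 0$ for all $u\in\mathcal{C}_1$,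 and $\mathcal{L}_\Delta(u)=0$ if and only if $u$ is affine linear. A function is simple piecewise linear if it has the form $u=\max\{0,f\}$ with $f$ an affine linear function. *)

theory Defs
  imports "HOL-Analysis.Analysis"
begin

section \<open>Moment polytopes of toric Fano manifolds\<close>

definition integer_lattice :: "(real ^ 'n) set" where
  "integer_lattice = {x. \<forall>i. x $ i \<in> \<int>}"

definition primitive_vector :: "real ^ 'n \<Rightarrow> bool" where
  "primitive_vector l \<longleftrightarrow> l \<in> integer_lattice \<and> l \<noteq> 0 \<and>
     (\<forall>k::int. \<forall>w\<in>integer_lattice. l = of_int k *\<^sub>R w \<longrightarrow> \<bar>k\<bar> = 1)"

definition lattice_basis :: "(real ^ 'n) set \<Rightarrow> bool" where
  "lattice_basis B \<longleftrightarrow> finite B \<and> B \<subseteq> integer_lattice \<and>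
     (\<forall>v\<in>integer_lattice. \<exists>!c. c \<in> B \<rightarrow>\<^sub>E (UNIV :: int set) \<and> v = (\<Sum>b\<in>B. of_int (c b) *\<^sub>R b))"

text \<open>The polytope is given by the set \<open>N\<close> of its facet normals \<open>l\<^sub>1, \<dots>, l\<^sub>d\<close>.\<close>

definition Delta :: "(real ^ 'n) set \<Rightarrow> (real ^ 'n) set" where
  "Delta N = {x. \<forall>l\<in>N. l \<bullet> x \<le> 1}"

definition facet :: "(real ^ 'n) set \<Rightarrow> real ^ 'n \<Rightarrow> (real ^ 'n) set" where
  "facet N l = {x \<in> Delta N. l \<bullet> x = 1}"

definition fano_moment_polytope :: "(real ^ 'n) set \<Rightarrow> bool" where
  "fano_moment_polytope N \<longleftrightarrow>
     finite N \<and> (\<forall>l\<in>N. primitive_vector l) \<and>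
     (\<exists>V. finite V \<and> V \<subseteq> integer_lattice \<and> Delta N = convex hull V) \<and>
     aff_dim (Delta N) = int CARD('n) \<and>
     (\<forall>l\<in>N. facet N l facet_of Delta N) \<and>
     (\<forall>v. v extreme_point_of Delta N \<longrightarrow>
        card {l\<in>N. v \<in> facet N l} = CARD('n) \<and> lattice_basis {l\<in>N. v \<in> facet N l})"


section \<open>Integration over the boundary\<close>

text \<open>
  Lebesgue measure of an affine subspace \<open>A\<close>, of dimension \<open>card B\<close>: the image of the product of
  one-dimensional Lebesgue measures under an isometric parametrisation of \<open>A\<close>, in the same way as
  \<^const>\<open>lborel\<close> is built from the standard basis. By rotation invariance it does not depend on
  the frame \<open>(p, B)\<close> chosen. It is completed, so that null sets may be ignored even for functions
  which are not Borel on them; if \<open>A\<close> is a point it is the unit point mass.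
\<close>

definition orthonormal_frame :: "'a::euclidean_space set \<Rightarrow> 'a \<times> 'a set \<Rightarrow> bool" where
  "orthonormal_frame A = (\<lambda>(p, B). pairwise orthogonal B \<and> (\<forall>b\<in>B. norm b = 1) \<and>
     A = (\<lambda>v. p + v) ` span B)"

definition affine_lebesgue :: "'a::euclidean_space set \<Rightarrow> 'a measure" where
  "affine_lebesgue A =
     (let (p, B) = (SOME pB. orthonormal_frame A pB)
      in completion (distr (\<Pi>\<^sub>M b\<in>B. lborel) borel (\<lambda>f. p + (\<Sum>b\<in>B. f b *\<^sub>R b))))"

definition hyperplane_lebesgue :: "real ^ 'n \<Rightarrow> (real ^ 'n) measure" where
  "hyperplane_lebesgue l = affine_lebesgue {x. l \<bullet> x = 1}"

text \<open>
  The integral with respect to \<open>d\<sigma> = |l|\<^sup>-\<^sup>1 d\<sigma>\<^sub>0\<close>. Distinct facets overlap in null sets only.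
\<close>

definition boundary_integral :: "(real ^ 'n) set \<Rightarrow> (real ^ 'n \<Rightarrow> real) \<Rightarrow> real" where
  "boundary_integral N u =
     (\<Sum>l\<in>N. (1 / norm l) * (LINT x:facet N l|hyperplane_lebesgue l. u x))"

definition boundary_integrable :: "(real ^ 'n) set \<Rightarrow> (real ^ 'n \<Rightarrow> real) \<Rightarrow> bool" where
  "boundary_integrable N u \<longleftrightarrow> (\<forall>l\<in>N. set_integrable (hyperplane_lebesgue l) (facet N l) u)"

definition avg_scalar_curvature :: "(real ^ 'n) set \<Rightarrow> real" where
  "avg_scalar_curvature N = boundary_integral N (\<lambda>_. 1) / measure lebesgue (Delta N)"


section \<open>The extremal potential and relative K-stability\<close>

definition affine_linear :: "(real ^ 'n \<Rightarrow> real) \<Rightarrow> bool" where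
  "affine_linear f \<longleftrightarrow> (\<exists>a c. f = (\<lambda>x. a \<bullet> x + c))"

definition simple_piecewise_linear :: "(real ^ 'n \<Rightarrow> real) \<Rightarrow> bool" where
  "simple_piecewise_linear u \<longleftrightarrow> (\<exists>f. affine_linear f \<and> u = (\<lambda>x. max 0 (f x)))"

definition stability_functional ::
    "(real ^ 'n) set \<Rightarrow> (real ^ 'n \<Rightarrow> real) \<Rightarrow> (real ^ 'n \<Rightarrow> real) \<Rightarrow> real" where
  "stability_functional N \<theta> u =
     boundary_integral N u - (LINT x:Delta N|lebesgue. (avg_scalar_curvature N + \<theta> x) * u x)"

definition extremal_potential :: "(real ^ 'n) set \<Rightarrow> real ^ 'n \<Rightarrow> real" where
  "extremal_potential N =
     (THE \<theta>. affine_linear \<theta> \<and> (\<forall>u. affine_linear u \<longrightarrow> stability_functional N \<theta> u = 0))"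

definition L_Delta :: "(real ^ 'n) set \<Rightarrow> (real ^ 'n \<Rightarrow> real) \<Rightarrow> real" where
  "L_Delta N u = stability_functional N (extremal_potential N) u"

definition Delta_star :: "(real ^ 'n) set \<Rightarrow> (real ^ 'n) set" where
  "Delta_star N = interior (Delta N) \<union> (\<Union>F\<in>{F. F facet_of Delta N}. rel_interior F)"

text \<open>
  A convex function on \<open>\<Delta>\<^sup>*\<close> is bounded below, and it is continuous on the interior of each facet,
  so finiteness of its boundary integral amounts to integrability. Values of \<open>u\<close> outside
  \<open>\<Delta>\<^sup>*\<close> are irrelevant: on \<open>\<Delta>\<close> they only concern null sets of the completed measures.
\<close>

definition C1 :: "(real ^ 'n) set \<Rightarrow> (real ^ 'n \<Rightarrow> real) set" where
  "C1 N = {u. convex_on (Delta_star N) u \<and> boundary_integrable N u}"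

definition relatively_strongly_K_stable :: "(real ^ 'n) set \<Rightarrow> bool" where
  "relatively_strongly_K_stable N \<longleftrightarrow>
     (\<forall>u\<in>C1 N. L_Delta N u \<ge> 0 \<and>
        (L_Delta N u = 0 \<longleftrightarrow> (\<exists>f. affine_linear f \<and> (\<forall>x\<in>Delta_star N. u x = f x))))"

definition Delta_minus :: "(real ^ 'n) set \<Rightarrow> (real ^ 'n) set" where
  "Delta_minus N = {x \<in> Delta N. 1 - extremal_potential N x < 0}"

end

theory Submission
  imports Defs
begin

text \<open>
  Every facet of \<open>\<Delta>\<close> has the equation \<open>\<langle>l, x\<rangle> = 1\<close>, so in polar coordinates around the origin
  \<open>\<integral>\<^bsub>\<Delta>\<^esub> g dx = \<integral>\<^bsub>\<partial>\<Delta>\<^esub> \<integral>\<^sub>0\<^sup>1 t\<^sup>n\<^sup>-\<^sup>1 g(t y) dt d\<sigma>(y)\<close>; in particular \<open>S = n\<close>.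

  For (1), subtract from \<open>u\<close> an affine function supporting it at the origin, which changes neither
  \<open>L(u)\<close> nor affinity. The result \<open>v \<ge> 0\<close> satisfies \<open>v(t y) \<le> t v(y)\<close>, hence
  \<open>\<integral>\<^bsub>\<partial>\<Delta>\<^esub> v d\<sigma> \<ge> (n + 1) \<integral>\<^bsub>\<Delta>\<^esub> v dx\<close> and \<open>L(v) \<ge> \<integral>\<^bsub>\<Delta>\<^esub> (1 - \<theta>) v dx \<ge> 0\<close>. In the case of equality \<open>v\<close>
  vanishes almost everywhere, and its zero set, being convex, contains the interior of \<open>\<Delta>\<close> and those
  of the facets.

  For (2), take \<open>u = max 0 (\<theta> - 1)\<close>: by the divergence theorem, \<open>L(u) = \<integral> (\<langle>x, \<nabla>u\<rangle> - \<theta> u) dx\<close>, which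
  is the integral of \<open>1 - c - (1 - \<theta>)\<^sup>2\<close> over \<open>\<Delta>\<^sup>-\<close>.
\<close>

subsection \<open>Integration along the rays through a hyperplane\<close>

text \<open>The functions in (1) are controlled on \<Delta>* only: they may blow up towards the
  lower-dimensional faces, jump up at the facets, and be arbitrary off \<Delta>*. So the divergence
  theorem is out of reach for them. The comparison along rays uses convexity alone, and
  integrability over \<Delta> is deduced from integrability over the boundary. Because of the jumps,
  vanishing on the interior does not force vanishing on the facets; in the case of equality the
  boundary integral has to be shown to vanish as well. That \<theta> \<le> 1 suffices there is due
  to the zero mean of \<theta>, which makes 1 - \<theta> strictly positive inside \<Delta>.

  The measure on a facet hyperplane comes from an unspecified orthonormal frame. Rotation invariance
  of Lebesgue measure makes the polar formula hold for whichever frame is chosen.\<close>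

lemma nn_integral_lborel_translate:
  fixes f :: "'a::euclidean_space \<Rightarrow> ennreal"
  assumes [measurable]: "f \<in> borel_measurable borel"
  shows "(\<integral>\<^sup>+x. f (c + x) \<partial>lborel) = (\<integral>\<^sup>+x. f x \<partial>lborel)"
proof -
  have "(\<integral>\<^sup>+x. f x \<partial>lborel) = (\<integral>\<^sup>+x. f x \<partial>distr lborel borel ((+) c))"
    by (simp add: lborel_distr_plus)
  then show ?thesis
    by (simp add: nn_integral_distr)
qed

text \<open>
  With \<open>B\<close> the unit ball, \<open>\<integral>\<integral> 1\<^sub>A(Tx) 1\<^sub>B(y - Tx) dx dy\<close> can be evaluated in either order: the pull-back
  of Lebesgue measure along \<open>T\<close> is proportional to it, and the ball fixes the factor.
\<close>
lemma distr_lborel_orthogonal_transformation: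
  fixes T :: "'a::euclidean_space \<Rightarrow> 'a"
  assumes T: "orthogonal_transformation T"
  shows "distr lborel borel T = lborel"
proof (rule measure_eqI)
  fix A assume "A \<in> sets (distr lborel borel T)"
  then have A[measurable]: "A \<in> sets borel" by simp
  have lin: "linear T" and surj: "surj T"
    using T by (auto simp: orthogonal_transformation_linear orthogonal_transformation_surj)
  have [measurable]: "T \<in> borel_measurable borel"
    using lin by (intro borel_measurable_continuous_onI linear_continuous_on linear_conv_bounded_linear[THEN iffD1])
  define B :: "'a set" where "B = ball 0 1"
  have [measurable]: "B \<in> sets borel" by (simp add: B_def)
  let ?f = "\<lambda>x y. indicator A (T x) * indicator B (y - T x) :: ennreal"
  have "emeasure lborel B * emeasure lborel (T -` A) = (\<integral>\<^sup>+x. emeasure lborel B * indicator (T -` A) x \<partial>lborel)"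
    by (subst nn_integral_cmult_indicator) (use measurable_sets_borel[of T borel A] in auto)
  also have "\<dots> = (\<integral>\<^sup>+x. (\<integral>\<^sup>+y. ?f x y \<partial>lborel) \<partial>lborel)"
  proof (rule nn_integral_cong)
    fix x :: 'a
    have "(\<integral>\<^sup>+y. ?f x y \<partial>lborel) = (\<integral>\<^sup>+y. ?f x (T x + y) \<partial>lborel)"
      by (subst nn_integral_lborel_translate) auto
    then show "emeasure lborel B * indicator (T -` A) x = (\<integral>\<^sup>+y. ?f x y \<partial>lborel)"
      by (simp add: nn_integral_cmult mult.commute split: split_indicator)
  qed
  also have "\<dots> = (\<integral>\<^sup>+y. (\<integral>\<^sup>+x. ?f x y \<partial>lborel) \<partial>lborel)"
    by (rule lborel_pair.Fubini'[symmetric]) measurable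
  also have "\<dots> = (\<integral>\<^sup>+y. (\<integral>\<^sup>+x. indicator A (T x + y) * indicator B x \<partial>lborel) \<partial>lborel)"
  proof (rule nn_integral_cong)
    fix y :: 'a
    obtain z where z: "T z = y" using surj by (metis surjD)
    have "(\<integral>\<^sup>+x. ?f x y \<partial>lborel) = (\<integral>\<^sup>+x. ?f (z + x) y \<partial>lborel)"
      by (rule nn_integral_lborel_translate[symmetric]) measurable
    also have "\<dots> = (\<integral>\<^sup>+x. indicator A (T x + y) * indicator B x \<partial>lborel)"
      by (intro nn_integral_cong)
         (simp add: linear_add[OF lin] z B_def indicator_def orthogonal_transformation_norm[OF T] add.commute)
    finally show "(\<integral>\<^sup>+x. ?f x y \<partial>lborel) = (\<integral>\<^sup>+x. indicator A (T x + y) * indicator B x \<partial>lborel)" .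
  qed
  also have "\<dots> = (\<integral>\<^sup>+x. (\<integral>\<^sup>+y. indicator A (T x + y) * indicator B x \<partial>lborel) \<partial>lborel)"
    by (rule lborel_pair.Fubini') measurable
  also have "\<dots> = (\<integral>\<^sup>+x. emeasure lborel A * indicator B x \<partial>lborel)"
    by (intro nn_integral_cong) (simp add: nn_integral_multc nn_integral_lborel_translate)
  also have "\<dots> = emeasure lborel A * emeasure lborel B"
    by (subst nn_integral_cmult_indicator) auto
  finally have eq: "emeasure lborel B * emeasure lborel (T -` A) = emeasure lborel B * emeasure lborel A"
    by (simp add: mult.commute)
  have "emeasure lborel B \<noteq> 0" "emeasure lborel B \<noteq> \<infinity>"
    using open_not_negligible[of B] emeasure_bounded_finite[of B] emeasure_lborel_ball_finite[of "0::'a" 1]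
    by (auto simp: B_def negligible_iff_emeasure0)
  then have "emeasure lborel (T -` A) = emeasure lborel A"
    using eq by (auto simp: ennreal_mult_cancel_left)
  then show "emeasure (distr lborel borel T) A = emeasure lborel A"
    by (simp add: emeasure_distr)
qed simp

interpretation lborel_prod: product_sigma_finite "\<lambda>_. lborel :: real measure" ..

text \<open>A bijection from the standard basis to \<open>B\<close> extends to an orthogonal map,
  which preserves \<open>lborel\<close>. It is needed for the frame of a facet hyperplane, enlarged
  by the unit normal, to serve as coordinates of the whole space.\<close>

lemma lborel_eq_orthonormal_PiM:
  fixes B :: "'a::euclidean_space set"
  assumes "finite B" "card B = DIM('a)" "pairwise orthogonal B" "\<And>b. b \<in> B \<Longrightarrow> norm b = 1"
  shows "lborel = distr (\<Pi>\<^sub>M b\<in>B. lborel) borel (\<lambda>f. \<Sum>b\<in>B. f b *\<^sub>R b)"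
proof -
  obtain \<pi> where \<pi>: "bij_betw \<pi> (Basis :: 'a set) B"
    using finite_same_card_bij[of "Basis :: 'a set" B] assms by auto
  have \<pi>B: "\<pi> i \<in> B" if "i \<in> Basis" for i
    using \<pi> that by (auto simp: bij_betw_def)
  define T where "T x = (\<Sum>i\<in>Basis. (x \<bullet> i) *\<^sub>R \<pi> i)" for x :: 'a
  have \<pi>_inner: "\<pi> i \<bullet> \<pi> j = (if i = j then 1 else 0)" if "i \<in> Basis" "j \<in> Basis" for i j
    using assms(3,4) \<pi>B[OF that(1)] \<pi>B[OF that(2)] bij_betw_imp_inj_on[OF \<pi>, THEN inj_onD, of i j] that
    by (auto simp: pairwise_def orthogonal_def dot_square_norm)
  have lin: "linear T"
    by (rule linearI) (auto simp: T_def inner_left_distrib scaleR_left_distrib sum.distrib scaleR_sum_right)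
  have "T v \<bullet> T w = v \<bullet> w" for v w
  proof -
    have "T v \<bullet> T w = (\<Sum>i\<in>Basis. (v \<bullet> i) * (w \<bullet> i))"
      by (simp add: T_def inner_sum_left inner_sum_right \<pi>_inner if_distrib mult.commute cong: if_cong)
    then show ?thesis by (simp add: euclidean_inner[of v w])
  qed
  then have "orthogonal_transformation T"
    using lin by (simp add: orthogonal_transformation_def)
  then have 1: "lborel = distr lborel borel T"
    by (simp add: distr_lborel_orthogonal_transformation)
  have 2: "(lborel :: 'a measure) = distr (\<Pi>\<^sub>M i\<in>Basis. lborel) borel (\<lambda>f. \<Sum>i\<in>Basis. f i *\<^sub>R i)"
    by (simp only: lborel_def[where 'a='a] lborel_eq_real)
  \<comment> \<open>Relabelling the factors along \<pi>; it is enough to compare the two measures on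
    boxes.\<close>
  have 3: "(\<Pi>\<^sub>M i\<in>(Basis::'a set). lborel :: real measure)
     = distr (\<Pi>\<^sub>M b\<in>B. lborel) (\<Pi>\<^sub>M i\<in>Basis. lborel) (\<lambda>f. \<lambda>i\<in>Basis. f (\<pi> i))"
  proof (rule lborel_prod.PiM_eqI[symmetric])
    fix A :: "'a \<Rightarrow> real set" assume A: "\<And>i. i \<in> Basis \<Longrightarrow> A i \<in> sets lborel"
    let ?\<rho> = "the_inv_into Basis \<pi>"
    have \<rho>: "?\<rho> (\<pi> i) = i" if "i \<in> Basis" for i
      using bij_betw_imp_inj_on[OF \<pi>] that by (simp add: the_inv_into_f_f)
    have \<rho>B: "?\<rho> b \<in> Basis" "\<pi> (?\<rho> b) = b" if "b \<in> B" for b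
      using \<pi> that by (auto simp: bij_betw_def the_inv_into_into f_the_inv_into_f)
    have "(\<lambda>f. \<lambda>i\<in>Basis. f (\<pi> i)) -` (Pi\<^sub>E Basis A) \<inter> space (\<Pi>\<^sub>M b\<in>B. lborel :: real measure)
        = Pi\<^sub>E B (\<lambda>b. A (?\<rho> b))"
      using \<rho> \<rho>B \<pi>B by (auto simp: space_PiM PiE_def Pi_def) metis+
    moreover have "emeasure (\<Pi>\<^sub>M b\<in>B. lborel) (Pi\<^sub>E B (\<lambda>b. A (?\<rho> b))) = (\<Prod>b\<in>B. emeasure lborel (A (?\<rho> b)))"
      using assms(1) A \<rho>B by (intro lborel_prod.emeasure_PiM) auto
    moreover have "\<dots> = (\<Prod>i\<in>Basis. emeasure lborel (A i))"
      by (subst prod.reindex_bij_betw[OF \<pi>, symmetric]) (simp add: \<rho>)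
    ultimately show "emeasure (distr (\<Pi>\<^sub>M b\<in>B. lborel) (\<Pi>\<^sub>M i\<in>Basis. lborel) (\<lambda>f. \<lambda>i\<in>Basis. f (\<pi> i))) (Pi\<^sub>E Basis A)
        = (\<Prod>i\<in>Basis. emeasure lborel (A i))"
      using A \<pi>B by (subst emeasure_distr) (auto intro!: sets_PiM_I_finite measurable_restrict)
  qed simp_all
  have "lborel = distr (distr (distr (\<Pi>\<^sub>M b\<in>B. lborel) (\<Pi>\<^sub>M i\<in>Basis. lborel) (\<lambda>f. \<lambda>i\<in>Basis. f (\<pi> i)))
      borel (\<lambda>f. \<Sum>i\<in>Basis. f i *\<^sub>R i)) borel T"
    unfolding 3[symmetric] 2[symmetric] by (rule 1)
  also have "\<dots> = distr (\<Pi>\<^sub>M b\<in>B. lborel) borel (\<lambda>f. T (\<Sum>i\<in>Basis. (\<lambda>i\<in>Basis. f (\<pi> i)) i *\<^sub>R i))"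
  proof -
    have [measurable]: "T \<in> borel_measurable borel"
      using lin by (intro borel_measurable_continuous_onI linear_continuous_on linear_conv_bounded_linear[THEN iffD1])
    have [measurable]: "(\<lambda>f. \<lambda>i\<in>Basis. f (\<pi> i)) \<in> (\<Pi>\<^sub>M b\<in>B. lborel :: real measure) \<rightarrow>\<^sub>M (\<Pi>\<^sub>M i\<in>Basis. lborel)"
      using \<pi>B by (intro measurable_restrict) auto
    show ?thesis
      by (subst distr_distr; (simp add: comp_def)?)
         (subst distr_distr; simp add: comp_def)
  qed
  also have "\<dots> = distr (\<Pi>\<^sub>M b\<in>B. lborel) borel (\<lambda>f. \<Sum>b\<in>B. f b *\<^sub>R b)"
  proof (rule distr_cong)
    fix f :: "'a \<Rightarrow> real"
    have "T (\<Sum>i\<in>Basis. (\<lambda>i\<in>Basis. f (\<pi> i)) i *\<^sub>R i) = (\<Sum>i\<in>Basis. f (\<pi> i) *\<^sub>R \<pi> i)"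
      by (simp add: T_def inner_sum_left inner_Basis if_distrib sum.delta cong: if_cong)
    then show "T (\<Sum>i\<in>Basis. (\<lambda>i\<in>Basis. f (\<pi> i)) i *\<^sub>R i) = (\<Sum>b\<in>B. f b *\<^sub>R b)"
      by (simp add: sum.reindex_bij_betw[OF \<pi>, of "\<lambda>b. f b *\<^sub>R b"])
  qed simp_all
  finally show ?thesis .
qed

text \<open>Each coordinate contributes a factor |t|, as is checked on boxes. In
  \<open>nn_integral_cone\<close> this scales the slice at height t to the one at height 1.\<close>

lemma nn_integral_PiM_lborel_affine:
  fixes g :: "('a \<Rightarrow> real) \<Rightarrow> ennreal"
  assumes B: "finite B" and t: "t \<noteq> 0" and g[measurable]: "g \<in> borel_measurable (\<Pi>\<^sub>M b\<in>B. lborel)"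
  shows "(\<integral>\<^sup>+f. g f \<partial>(\<Pi>\<^sub>M b\<in>B. lborel))
    = ennreal (\<bar>t\<bar> ^ card B) * (\<integral>\<^sup>+f. g (\<lambda>b\<in>B. q b + t * f b) \<partial>(\<Pi>\<^sub>M b\<in>B. lborel))"
proof -
  let ?M = "\<Pi>\<^sub>M b\<in>B. lborel :: real measure" and ?F = "\<lambda>f. \<lambda>b\<in>B. q b + t * f b"
  have [measurable]: "?F \<in> ?M \<rightarrow>\<^sub>M ?M"
    by (intro measurable_restrict) measurable
  have "density (distr ?M ?M ?F) (\<lambda>_. ennreal (\<bar>t\<bar> ^ card B)) = ?M"
  proof (rule lborel_prod.PiM_eqI)
    fix A :: "'a \<Rightarrow> real set" assume A: "\<And>b. b \<in> B \<Longrightarrow> A b \<in> sets lborel"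
    have pre: "?F -` Pi\<^sub>E B A \<inter> space ?M = Pi\<^sub>E B (\<lambda>b. (\<lambda>x. q b + t * x) -` A b)"
      by (auto simp: space_PiM PiE_def Pi_def)
    have m: "(\<lambda>x. q b + t * x) -` A b \<in> sets lborel" if "b \<in> B" for b
      using A[OF that] measurable_sets_borel[of "\<lambda>x. q b + t * x" borel "A b"] by auto
    have e: "emeasure lborel (A b) = ennreal \<bar>t\<bar> * emeasure lborel ((\<lambda>x. q b + t * x) -` A b)" if "b \<in> B" for b
      using A[OF that]
      by (subst lborel_real_affine[OF t, of "q b"]) (simp add: emeasure_density_const emeasure_distr)
    have "emeasure (density (distr ?M ?M ?F) (\<lambda>_. ennreal (\<bar>t\<bar> ^ card B))) (Pi\<^sub>E B A)
        = ennreal (\<bar>t\<bar> ^ card B) * emeasure ?M (Pi\<^sub>E B (\<lambda>b. (\<lambda>x. q b + t * x) -` A b))"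
      using A B by (subst emeasure_density_const) (auto simp: emeasure_distr pre intro!: sets_PiM_I_finite)
    also have "\<dots> = (\<Prod>b\<in>B. ennreal \<bar>t\<bar> * emeasure lborel ((\<lambda>x. q b + t * x) -` A b))"
      using B m by (subst lborel_prod.emeasure_PiM) (auto simp: prod.distrib ennreal_power)
    finally show "emeasure (density (distr ?M ?M ?F) (\<lambda>_. ennreal (\<bar>t\<bar> ^ card B))) (Pi\<^sub>E B A)
        = (\<Prod>b\<in>B. emeasure lborel (A b))"
      by (simp add: e)
  qed (use B in auto)
  then have "(\<integral>\<^sup>+f. g f \<partial>?M) = (\<integral>\<^sup>+f. g f \<partial>density (distr ?M ?M ?F) (\<lambda>_. ennreal (\<bar>t\<bar> ^ card B)))"
    by simp
  then show ?thesis
    by (simp add: nn_integral_density nn_integral_distr nn_integral_cmult)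
qed

text \<open>Only the defining property of the frame chosen by \<open>SOME\<close> is available, and
  only once some frame exists: the multiple of \<open>l\<close> on the hyperplane, with an
  orthonormal basis of the complement of \<open>l\<close>. The chosen base point \<open>p\<close>
  may be any point of the hyperplane; \<open>q\<close> records its offset from that
  multiple.\<close>

lemma hyperplane_lebesgue_frame:
  fixes l :: "real ^ 'n"
  assumes l: "l \<noteq> 0"
  obtains p B q where "finite B" "card B = CARD('n) - 1" "pairwise orthogonal B"
    "\<forall>b\<in>B. norm b = 1" "\<forall>b\<in>B. l \<bullet> b = 0"
    "p = (1 / (l \<bullet> l)) *\<^sub>R l + (\<Sum>b\<in>B. q b *\<^sub>R b)"
    "hyperplane_lebesgue l = completion (distr (\<Pi>\<^sub>M b\<in>B. lborel) borel (\<lambda>f. p + (\<Sum>b\<in>B. f b *\<^sub>R b)))"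
proof -
  let ?H = "{x. l \<bullet> x = 1}" and ?x = "(1 / (l \<bullet> l)) *\<^sub>R l"
  have x: "l \<bullet> ?x = 1" using l by simp
  obtain B0 where B0: "pairwise orthogonal B0" "\<And>b. b \<in> B0 \<Longrightarrow> norm b = 1" "span B0 = {x. l \<bullet> x = 0}"
    using orthonormal_basis_subspace[OF subspace_hyperplane[of l]] by metis
  have "?H = (\<lambda>v. ?x + v) ` {x. l \<bullet> x = 0}"
  proof (intro set_eqI iffI)
    fix y assume "y \<in> ?H"
    then have "y = ?x + (y - ?x)" "y - ?x \<in> {x. l \<bullet> x = 0}"
      using x by (simp_all add: inner_diff_right)
    then show "y \<in> (\<lambda>v. ?x + v) ` {x. l \<bullet> x = 0}" by (rule image_eqI)
  qed (use x in \<open>auto simp: inner_add_right\<close>)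
  then have "orthonormal_frame ?H (?x, B0)"
    using B0 by (simp add: orthonormal_frame_def)
  then have fr: "orthonormal_frame ?H (SOME pB. orthonormal_frame ?H pB)"
    by (rule someI)
  obtain p B where pB: "(SOME pB. orthonormal_frame ?H pB) = (p, B)"
    by (cases "SOME pB. orthonormal_frame ?H pB")
  have fr: "orthonormal_frame ?H (p, B)" using fr pB by simp
  have B: "pairwise orthogonal B" "\<forall>b\<in>B. norm b = 1" and H: "?H = (\<lambda>v. p + v) ` span B"
    using fr by (auto simp: orthonormal_frame_def)
  have p: "l \<bullet> p = 1"
    using H span_zero[of B] by (metis (mono_tags, lifting) add.right_neutral imageI mem_Collect_eq)
  have span: "span B = {x. l \<bullet> x = 0}"
  proof (intro set_eqI iffI)
    fix v assume "v \<in> span B"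
    then have "p + v \<in> ?H" using H by blast
    then show "v \<in> {x. l \<bullet> x = 0}" using p by (simp add: inner_add_right)
  next
    fix v assume "v \<in> {x. l \<bullet> x = 0}"
    then have "p + v \<in> ?H" using p by (simp add: inner_add_right)
    then show "v \<in> span B" unfolding H by auto
  qed
  have "independent B"
    using B by (intro pairwise_orthogonal_independent) auto
  then have fin: "finite B" and "card B = dim (span B)"
    by (simp_all add: independent_imp_finite dim_eq_card_independent)
  then have card: "card B = CARD('n) - 1"
    using l by (simp add: span dim_hyperplane)
  have "p - ?x \<in> span B"
    using p x by (simp add: span inner_diff_right)
  then obtain q where "p - ?x = (\<Sum>b\<in>B. q b *\<^sub>R b)"
    by (auto simp: span_finite[OF fin])
  then have q: "p = ?x + (\<Sum>b\<in>B. q b *\<^sub>R b)" by (simp add: algebra_simps)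
  have lB: "\<forall>b\<in>B. l \<bullet> b = 0"
    using span_base[of _ B] by (simp add: span)
  show thesis
    by (rule that[OF fin card B lB q]) (auto simp: hyperplane_lebesgue_def affine_lebesgue_def pB)
qed

lemma AE_hyperplane_lebesgue:
  fixes l :: "real ^ 'n"
  assumes "l \<noteq> 0"
  shows "AE y in hyperplane_lebesgue l. l \<bullet> y = 1"
proof -
  obtain p B q where fin: "finite B" and card: "card B = CARD('n) - 1"
    and B: "pairwise orthogonal B" "\<forall>b\<in>B. norm b = 1" "\<forall>b\<in>B. l \<bullet> b = 0"
    and p: "p = (1 / (l \<bullet> l)) *\<^sub>R l + (\<Sum>b\<in>B. q b *\<^sub>R b)"
    and h: "hyperplane_lebesgue l = completion (distr (\<Pi>\<^sub>M b\<in>B. lborel) borel (\<lambda>f. p + (\<Sum>b\<in>B. f b *\<^sub>R b)))"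
    by (rule hyperplane_lebesgue_frame[OF assms]) (rule that)
  have "l \<bullet> p = 1"
    using assms B(3) by (simp add: p inner_add_right inner_sum_right)
  then show ?thesis
    unfolding h using B(3)
    by (intro AE_completion) (subst AE_distr_iff, auto simp: inner_add_right inner_sum_right)
qed

lemma sets_hyperplane_lebesgue:
  fixes l :: "real ^ 'n"
  assumes "l \<noteq> 0" "A \<in> sets borel"
  shows "A \<in> sets (hyperplane_lebesgue l)"
proof -
  obtain p B q where fin: "finite B" and card: "card B = CARD('n) - 1"
    and B: "pairwise orthogonal B" "\<forall>b\<in>B. norm b = 1" "\<forall>b\<in>B. l \<bullet> b = 0"
    and p: "p = (1 / (l \<bullet> l)) *\<^sub>R l + (\<Sum>b\<in>B. q b *\<^sub>R b)"
    and h: "hyperplane_lebesgue l = completion (distr (\<Pi>\<^sub>M b\<in>B. lborel) borel (\<lambda>f. p + (\<Sum>b\<in>B. f b *\<^sub>R b)))"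
    by (rule hyperplane_lebesgue_frame[OF assms(1)]) (rule that)
  show ?thesis
    unfolding h using assms(2) by (intro sets_completionI_sets) simp
qed

lemma borel_measurable_hyperplane_lebesgue:
  fixes l :: "real ^ 'n"
  assumes "l \<noteq> 0" "f \<in> borel \<rightarrow>\<^sub>M M"
  shows "f \<in> hyperplane_lebesgue l \<rightarrow>\<^sub>M M"
proof -
  obtain p B q where fin: "finite B" and card: "card B = CARD('n) - 1"
    and B: "pairwise orthogonal B" "\<forall>b\<in>B. norm b = 1" "\<forall>b\<in>B. l \<bullet> b = 0"
    and p: "p = (1 / (l \<bullet> l)) *\<^sub>R l + (\<Sum>b\<in>B. q b *\<^sub>R b)"
    and h: "hyperplane_lebesgue l = completion (distr (\<Pi>\<^sub>M b\<in>B. lborel) borel (\<lambda>f. p + (\<Sum>b\<in>B. f b *\<^sub>R b)))"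
    by (rule hyperplane_lebesgue_frame[OF assms(1)]) (rule that)
  show ?thesis
    unfolding h using assms(2) by (intro measurable_completion) simp
qed

lemma space_hyperplane_lebesgue:
  fixes l :: "real ^ 'n"
  assumes "l \<noteq> 0"
  shows "space (hyperplane_lebesgue l) = UNIV"
proof -
  obtain p B q where fin: "finite B" and card: "card B = CARD('n) - 1"
    and B: "pairwise orthogonal B" "\<forall>b\<in>B. norm b = 1" "\<forall>b\<in>B. l \<bullet> b = 0"
    and p: "p = (1 / (l \<bullet> l)) *\<^sub>R l + (\<Sum>b\<in>B. q b *\<^sub>R b)"
    and h: "hyperplane_lebesgue l = completion (distr (\<Pi>\<^sub>M b\<in>B. lborel) borel (\<lambda>f. p + (\<Sum>b\<in>B. f b *\<^sub>R b)))"
    by (rule hyperplane_lebesgue_frame[OF assms]) (rule that)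
  show ?thesis
    unfolding h by simp
qed

text \<open>
  In the coordinates \<open>x = s l / |l| + \<Sum> f\<^sub>b b\<close> the point \<open>t y\<close> of the ray through
  \<open>y = p + \<Sum> f'\<^sub>b b\<close> has \<open>s = t / |l|\<close> and \<open>f = t (q + f')\<close>, whence the Jacobian \<open>t\<^sup>n\<^sup>-\<^sup>1 / |l|\<close>.
\<close>
lemma nn_integral_cone:
  fixes l :: "real ^ 'n" and g :: "real ^ 'n \<Rightarrow> ennreal"
  assumes l: "l \<noteq> 0" and g[measurable]: "g \<in> borel_measurable borel"
  shows "(\<integral>\<^sup>+x. g x * indicator {x. l \<bullet> x > 0} x \<partial>lborel)
    = ennreal (1 / norm l) * (\<integral>\<^sup>+y. (\<integral>\<^sup>+t. ennreal (t ^ (CARD('n) - 1)) * g (t *\<^sub>R y) * indicator {0<..} t \<partial>lborel)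
        \<partial>hyperplane_lebesgue l)"
proof -
  obtain p B q where fin: "finite B" and card: "card B = CARD('n) - 1"
    and B: "pairwise orthogonal B" "\<forall>b\<in>B. norm b = 1" "\<forall>b\<in>B. l \<bullet> b = 0"
    and p: "p = (1 / (l \<bullet> l)) *\<^sub>R l + (\<Sum>b\<in>B. q b *\<^sub>R b)"
    and h: "hyperplane_lebesgue l = completion (distr (\<Pi>\<^sub>M b\<in>B. lborel) borel (\<lambda>f. p + (\<Sum>b\<in>B. f b *\<^sub>R b)))"
    by (rule hyperplane_lebesgue_frame[OF l]) (rule that)
  let ?P = "\<Pi>\<^sub>M b\<in>B. (lborel :: real measure)" and ?k = "CARD('n) - 1"
  define e where "e = (1 / norm l) *\<^sub>R l"
  define h where "h x = g x * indicator {x. l \<bullet> x > 0} x" for x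
  have [measurable]: "h \<in> borel_measurable borel" unfolding h_def by measurable
  have e: "norm e = 1" "l \<bullet> e = norm l" using l by (simp_all add: e_def dot_square_norm power2_eq_square)
  have eB: "e \<notin> B" using B(3) e l by auto
  have orth: "pairwise orthogonal (insert e B)"
    using B(1,3) by (auto simp: pairwise_insert orthogonal_def e_def inner_commute)
  have pe: "p = (1 / norm l) *\<^sub>R e + (\<Sum>b\<in>B. q b *\<^sub>R b)"
    by (simp add: p e_def dot_square_norm power2_eq_square)
  have "(\<integral>\<^sup>+x. h x \<partial>lborel) = (\<integral>\<^sup>+f. h (\<Sum>b\<in>insert e B. f b *\<^sub>R b) \<partial>(\<Pi>\<^sub>M b\<in>insert e B. lborel))"
    by (subst lborel_eq_orthonormal_PiM[of "insert e B"])
       (use fin card eB orth B(2) e in \<open>auto simp: nn_integral_distr\<close>)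
  also have "\<dots> = (\<integral>\<^sup>+s. (\<integral>\<^sup>+f. h (\<Sum>b\<in>insert e B. (f(e := s)) b *\<^sub>R b) \<partial>?P) \<partial>lborel)"
    using fin eB by (intro lborel_prod.product_nn_integral_insert_rev) measurable
  also have "\<dots> = (\<integral>\<^sup>+s. (\<integral>\<^sup>+f. h (s *\<^sub>R e + (\<Sum>b\<in>B. f b *\<^sub>R b)) \<partial>?P) \<partial>lborel)"
  proof -
    have "(\<Sum>b\<in>insert e B. (f(e := s)) b *\<^sub>R b) = s *\<^sub>R e + (\<Sum>b\<in>B. f b *\<^sub>R b)" for s f
      using fin eB by (auto intro!: sum.cong)
    then show ?thesis by presburger
  qed
  also have "\<dots> = ennreal (1 / norm l) * (\<integral>\<^sup>+t. (\<integral>\<^sup>+f. h ((t / norm l) *\<^sub>R e + (\<Sum>b\<in>B. f b *\<^sub>R b)) \<partial>?P) \<partial>lborel)"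
  proof -
    interpret finite_product_sigma_finite "\<lambda>_. lborel" B by standard (rule fin)
    show ?thesis
      using l by (subst nn_integral_real_affine[where c = "1 / norm l" and t = 0]) simp_all
  qed
  also have "(\<integral>\<^sup>+t. (\<integral>\<^sup>+f. h ((t / norm l) *\<^sub>R e + (\<Sum>b\<in>B. f b *\<^sub>R b)) \<partial>?P) \<partial>lborel)
      = (\<integral>\<^sup>+t. (\<integral>\<^sup>+f. ennreal (t ^ ?k) * g (t *\<^sub>R (p + (\<Sum>b\<in>B. f b *\<^sub>R b))) * indicator {0<..} t \<partial>?P) \<partial>lborel)"
  proof (rule nn_integral_cong)
    fix t :: real
    have lt: "l \<bullet> ((t / norm l) *\<^sub>R e + (\<Sum>b\<in>B. f b *\<^sub>R b)) = t" for f
      using B(3) e l by (simp add: inner_add_right inner_sum_right)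
    show "(\<integral>\<^sup>+f. h ((t / norm l) *\<^sub>R e + (\<Sum>b\<in>B. f b *\<^sub>R b)) \<partial>?P)
      = (\<integral>\<^sup>+f. ennreal (t ^ ?k) * g (t *\<^sub>R (p + (\<Sum>b\<in>B. f b *\<^sub>R b))) * indicator {0<..} t \<partial>?P)"
    proof (cases "t > 0")
      case False
      then show ?thesis using lt by (simp add: h_def)
    next
      case True
      have "(\<integral>\<^sup>+f. h ((t / norm l) *\<^sub>R e + (\<Sum>b\<in>B. f b *\<^sub>R b)) \<partial>?P) =
        ennreal (\<bar>t\<bar> ^ card B) * (\<integral>\<^sup>+f. h ((t / norm l) *\<^sub>R e + (\<Sum>b\<in>B. (\<lambda>b\<in>B. t * q b + t * f b) b *\<^sub>R b)) \<partial>?P)"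
        using True fin by (intro nn_integral_PiM_lborel_affine) auto
      also have "(\<lambda>f. (t / norm l) *\<^sub>R e + (\<Sum>b\<in>B. (\<lambda>b\<in>B. t * q b + t * f b) b *\<^sub>R b))
          = (\<lambda>f. t *\<^sub>R (p + (\<Sum>b\<in>B. f b *\<^sub>R b)))"
        by (simp add: pe scaleR_add_right scaleR_add_left sum.distrib scaleR_sum_right fun_eq_iff)
      then have "(\<integral>\<^sup>+f. h ((t / norm l) *\<^sub>R e + (\<Sum>b\<in>B. (\<lambda>b\<in>B. t * q b + t * f b) b *\<^sub>R b)) \<partial>?P)
          = (\<integral>\<^sup>+f. h (t *\<^sub>R (p + (\<Sum>b\<in>B. f b *\<^sub>R b))) \<partial>?P)"
        by (simp add: fun_eq_iff)
      also have "\<dots> = (\<integral>\<^sup>+f. g (t *\<^sub>R (p + (\<Sum>b\<in>B. f b *\<^sub>R b))) \<partial>?P)"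
      proof -
        have "l \<bullet> (p + (\<Sum>b\<in>B. f b *\<^sub>R b)) = 1" for f
          using B(3) e l by (simp add: pe inner_add_right inner_sum_right)
        then show ?thesis using True by (simp add: h_def)
      qed
      finally show ?thesis
        using True by (simp add: nn_integral_cmult card)
    qed
  qed
  also have "\<dots> = (\<integral>\<^sup>+f. (\<integral>\<^sup>+t. ennreal (t ^ ?k) * g (t *\<^sub>R (p + (\<Sum>b\<in>B. f b *\<^sub>R b))) * indicator {0<..} t \<partial>lborel) \<partial>?P)"
  proof -
    interpret F: finite_product_sigma_finite "\<lambda>_. lborel" B by standard (rule fin)
    interpret pair_sigma_finite ?P lborel ..
    show ?thesis by (rule Fubini') measurable
  qed
  also have "\<dots> = (\<integral>\<^sup>+y. (\<integral>\<^sup>+t. ennreal (t ^ ?k) * g (t *\<^sub>R y) * indicator {0<..} t \<partial>lborel) \<partial>hyperplane_lebesgue l)"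
    unfolding \<open>hyperplane_lebesgue l = _\<close> nn_integral_completion
    by (subst nn_integral_distr) auto
  finally show ?thesis by (simp add: h_def)
qed

lemma ray_integral_power: "((\<lambda>t. t ^ k) has_integral (1 / (real k + 1))) {0..1::real}"
proof -
  have "((\<lambda>t. t ^ k) has_integral (1 ^ Suc k / real (Suc k) - 0 ^ Suc k / real (Suc k))) {0..1::real}"
    by (intro fundamental_theorem_of_calculus)
       (auto intro!: derivative_eq_intros simp: has_real_derivative_iff_has_vector_derivative[symmetric] simp del: power_Suc of_nat_Suc)
  then show ?thesis by (simp add: add.commute)
qed

text \<open>On a cone the integrand along each ray is constant up to the weight, so the polar
  formula gives \<open>?c / norm l\<close> times the hyperplane measure. The factor
  \<open>?c\<close> is infinite, hence only null sets can be compared. The gain is that they can be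
  recognised in the ambient space, where hyperplanes are null and nonempty open sets are
  not.\<close>

lemma hyperplane_lebesgue_cone_null_iff:
  fixes l :: "real ^ 'n"
  assumes l: "l \<noteq> 0" and A[measurable]: "A \<in> sets borel"
    and cone: "\<And>t y. t > 0 \<Longrightarrow> t *\<^sub>R y \<in> A \<longleftrightarrow> y \<in> A"
  shows "(AE y in hyperplane_lebesgue l. y \<notin> A) \<longleftrightarrow> emeasure lborel (A \<inter> {x. l \<bullet> x > 0}) = 0"
proof -
  let ?c = "\<integral>\<^sup>+t. ennreal (t ^ (CARD('n) - 1)) * indicator {0<..} t \<partial>lborel"
  have A': "A \<in> sets (hyperplane_lebesgue l)"
    using l A by (rule sets_hyperplane_lebesgue)
  \<comment> \<open>On [1, 2] the weight is at least 1, so \<open>?c\<close> is not zero.\<close>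
  have "1 = (\<integral>\<^sup>+t. indicator {1..2::real} t \<partial>lborel)" by simp
  also have "\<dots> \<le> ?c"
    by (intro nn_integral_mono) (auto simp: indicator_def ennreal_ge_1)
  finally have c: "?c \<noteq> 0" by auto
  have "emeasure lborel (A \<inter> {x. l \<bullet> x > 0}) = (\<integral>\<^sup>+x. indicator A x * indicator {x. l \<bullet> x > 0} x \<partial>lborel)"
    by (simp add: nn_integral_indicator[symmetric] indicator_inter_arith del: nn_integral_indicator)
  also have "\<dots> = ennreal (1 / norm l) * (\<integral>\<^sup>+y. (\<integral>\<^sup>+t. ennreal (t ^ (CARD('n) - 1)) * indicator A (t *\<^sub>R y)
      * indicator {0<..} t \<partial>lborel) \<partial>hyperplane_lebesgue l)"
    using l by (intro nn_integral_cone) auto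
  also have "(\<integral>\<^sup>+y. (\<integral>\<^sup>+t. ennreal (t ^ (CARD('n) - 1)) * indicator A (t *\<^sub>R y)
      * indicator {0<..} t \<partial>lborel) \<partial>hyperplane_lebesgue l) = (\<integral>\<^sup>+y. ?c * indicator A y \<partial>hyperplane_lebesgue l)"
  proof (rule nn_integral_cong)
    fix y
    have "(\<integral>\<^sup>+t. ennreal (t ^ (CARD('n) - 1)) * indicator A (t *\<^sub>R y) * indicator {0<..} t \<partial>lborel)
        = (\<integral>\<^sup>+t. (ennreal (t ^ (CARD('n) - 1)) * indicator {0<..} t) * indicator A y \<partial>lborel)"
      by (intro nn_integral_cong) (auto simp: cone split: split_indicator)
    then show "(\<integral>\<^sup>+t. ennreal (t ^ (CARD('n) - 1)) * indicator A (t *\<^sub>R y) * indicator {0<..} t \<partial>lborel) = ?c * indicator A y"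
      by (simp add: nn_integral_multc)
  qed
  also have "\<dots> = ?c * emeasure (hyperplane_lebesgue l) A"
    using A' by (rule nn_integral_cmult_indicator)
  finally have "emeasure lborel (A \<inter> {x. l \<bullet> x > 0}) = 0 \<longleftrightarrow> emeasure (hyperplane_lebesgue l) A = 0"
    using c l by simp
  also have "\<dots> \<longleftrightarrow> (AE y in hyperplane_lebesgue l. y \<notin> A)"
    using A' l by (subst AE_iff_measurable[of A]) (auto simp: space_hyperplane_lebesgue)
  finally show ?thesis by simp
qed

section \<open>Convex functions: zero sets and supporting affine functions\<close>

lemma convex_zero_set:
  assumes v: "convex_on S v" "\<And>x. x \<in> S \<Longrightarrow> 0 \<le> v x" and T: "convex T" "T \<subseteq> S"
  shows "convex {x \<in> T. v x = 0}"
proof (rule convexI)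
  fix x y and s t :: real
  assume xy: "x \<in> {x \<in> T. v x = 0}" "y \<in> {x \<in> T. v x = 0}" and st: "0 \<le> s" "0 \<le> t" "s + t = 1"
  have z: "s *\<^sub>R x + t *\<^sub>R y \<in> T" using convexD[OF T(1)] xy st by auto
  have "v (s *\<^sub>R x + t *\<^sub>R y) \<le> s * v x + t * v y"
    using v(1) xy st T(2) unfolding convex_on_def by blast
  then show "s *\<^sub>R x + t *\<^sub>R y \<in> {x \<in> T. v x = 0}"
    using xy z v(2) T(2) by (auto intro: antisym)
qed

text \<open>A subgradient at an interior point, read off from a hyperplane that separates the point
  of the graph from the epigraph.\<close>

lemma convex_on_affine_minorant:
  fixes f :: "'a::euclidean_space \<Rightarrow> real"
  assumes f: "convex_on S f" and x0: "x0 \<in> interior S"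
  obtains a where "\<And>x. x \<in> S \<Longrightarrow> f x0 + a \<bullet> (x - x0) \<le> f x"
proof -
  \<comment> \<open>The strict epigraph omits the graph, so it can be separated from
    \<open>(x0, f x0)\<close> without any closedness.\<close>
  define E where "E = {(x, r). x \<in> S \<and> f x < r}"
  have x0S: "x0 \<in> S" using x0 interior_subset by blast
  have "convex S" using f by (simp add: convex_on_def)
  have "convex E"
  proof (rule convexI)
    fix p q and u v :: real
    assume p: "p \<in> E" "q \<in> E" and u: "0 \<le> u" "0 \<le> v" "u + v = 1"
    obtain x r y s where xy: "p = (x, r)" "q = (y, s)" "x \<in> S" "y \<in> S" "f x < r" "f y < s"
      using p by (auto simp: E_def)
    have "f (u *\<^sub>R x + v *\<^sub>R y) \<le> u * f x + v * f y"
      using f xy u by (auto simp: convex_on_def)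
    also have "\<dots> < u * r + v * s"
    proof (cases "u = 0")
      case False
      then show ?thesis using xy u by (intro add_less_le_mono) (auto intro: mult_left_mono)
    qed (use u xy in auto)
    finally show "u *\<^sub>R p + v *\<^sub>R q \<in> E"
      using xy u convexD[OF \<open>convex S\<close>, of x y u v] by (simp add: E_def)
  qed
  moreover have "(x0, f x0 + 1) \<in> E" using x0S by (simp add: E_def)
  then have "E \<noteq> {}" by blast
  moreover have "E \<inter> {(x0, f x0)} = {}" by (auto simp: E_def)
  ultimately obtain p b where p: "p \<noteq> 0" "\<forall>x\<in>E. p \<bullet> x \<le> b" "\<forall>x\<in>{(x0, f x0)}. p \<bullet> x \<ge> b"
    using separating_hyperplane_sets[of E "{(x0, f x0)}"] by (metis convex_singleton insert_not_empty)
  obtain \<alpha> \<beta> where \<alpha>\<beta>: "p = (\<alpha>, \<beta>)" by (cases p)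
  have sep: "\<alpha> \<bullet> x + \<beta> * r \<le> \<alpha> \<bullet> x0 + \<beta> * f x0" if "x \<in> S" "f x < r" for x r
  proof -
    have "p \<bullet> (x, r) \<le> p \<bullet> (x0, f x0)"
      using p(2,3) that by (force simp: E_def)
    then show ?thesis by (simp add: \<alpha>\<beta>)
  qed
  have "\<beta> \<le> 0" using sep[OF x0S, of "f x0 + 1"] by (simp add: distrib_left)
  \<comment> \<open>A vertical hyperplane would support \<open>S\<close> at \<open>x0\<close>,
    impossible at an interior point.\<close>
  have "\<beta> \<noteq> 0"
  proof
    assume \<beta>: "\<beta> = 0"
    have le: "\<alpha> \<bullet> x \<le> \<alpha> \<bullet> x0" if "x \<in> S" for x
      using sep[OF that, of "f x + 1"] by (simp add: \<beta>)
    have "interior S \<subseteq> interior {x. \<alpha> \<bullet> x \<le> \<alpha> \<bullet> x0}"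
      using le by (intro interior_mono) auto
    moreover have "\<alpha> \<noteq> 0" using p(1) by (auto simp: \<alpha>\<beta> \<beta> zero_prod_def)
    ultimately show False using x0 by auto
  qed
  with \<open>\<beta> \<le> 0\<close> have \<beta>: "\<beta> < 0" by simp
  show thesis
  proof (rule that[of "(- 1 / \<beta>) *\<^sub>R \<alpha>"])
    fix x assume x: "x \<in> S"
    have "f x0 + ((- 1 / \<beta>) *\<^sub>R \<alpha>) \<bullet> (x - x0) \<le> r" if "f x < r" for r
    proof -
      have "\<alpha> \<bullet> (x - x0) \<le> (- \<beta>) * (r - f x0)"
        using sep[OF x that] by (simp add: inner_diff_right algebra_simps)
      then have "(\<alpha> \<bullet> (x - x0)) / (- \<beta>) \<le> r - f x0"
        using \<beta> by (subst pos_divide_le_eq) (auto simp: mult.commute)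
      then show ?thesis by (simp add: divide_inverse mult.commute)
    qed
    \<comment> \<open>The separation only speaks of \<open>r\<close> strictly above
      \<open>f x\<close>; let \<open>r\<close> decrease to \<open>f x\<close>.\<close>
    then show "f x0 + ((- 1 / \<beta>) *\<^sub>R \<alpha>) \<bullet> (x - x0) \<le> f x"
      by (rule dense_ge)
  qed
qed

subsection \<open>Polytopes with all facets at height one\<close>

locale polytope_at_unit_distance =
  fixes N :: "(real ^ 'n) set"
  assumes finite_N: "finite N"
    and bounded_Delta: "bounded (Delta N)"
    and facet_facet_of: "\<And>l. l \<in> N \<Longrightarrow> facet N l facet_of Delta N"
begin

lemma normal_nonzero:
  assumes "l \<in> N"
  shows "l \<noteq> 0"
proof -
  have "facet N l \<noteq> {}" using facet_facet_of[OF assms] by (simp add: facet_of_def)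
  then show ?thesis by (auto simp: facet_def)
qed

lemma Delta_eq: "Delta N = (\<Inter>l\<in>N. {x. l \<bullet> x \<le> 1})"
  by (auto simp: Delta_def)

lemma closed_Delta: "closed (Delta N)"
  by (simp add: Delta_eq closed_INT closed_halfspace_le)

lemma convex_Delta: "convex (Delta N)"
  by (simp add: Delta_eq convex_INT convex_halfspace_le)

lemma compact_Delta: "compact (Delta N)"
  using closed_Delta bounded_Delta by (simp add: compact_eq_bounded_closed)

lemma interior_Delta: "interior (Delta N) = {x. \<forall>l\<in>N. l \<bullet> x < 1}"
proof
  have "{x. \<forall>l\<in>N. l \<bullet> x < 1} = (\<Inter>l\<in>N. {x. l \<bullet> x < 1})" by auto
  then have "open {x. \<forall>l\<in>N. l \<bullet> x < 1}"
    using finite_N by (simp add: open_INT open_halfspace_lt)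
  then show "{x. \<forall>l\<in>N. l \<bullet> x < 1} \<subseteq> interior (Delta N)"
    by (intro interior_maximal) (auto simp: Delta_def intro: less_imp_le)
next
  show "interior (Delta N) \<subseteq> {x. \<forall>l\<in>N. l \<bullet> x < 1}"
  proof (intro subsetI CollectI ballI)
    fix x l assume x: "x \<in> interior (Delta N)" and l: "l \<in> N"
    have "interior (Delta N) \<subseteq> interior {x. l \<bullet> x \<le> 1}"
      using l by (intro interior_mono) (auto simp: Delta_def)
    then show "l \<bullet> x < 1"
      using x normal_nonzero[OF l] by auto
  qed
qed

lemma zero_in_interior: "0 \<in> interior (Delta N)"
  by (simp add: interior_Delta)

lemma closure_interior_Delta: "closure (interior (Delta N)) = Delta N"
  using convex_closure_interior[OF convex_Delta] zero_in_interior closed_Delta by auto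

lemma negligible_frontier_Delta: "negligible (frontier (Delta N))"
  by (rule negligible_convex_frontier[OF convex_Delta])

lemma sets_Delta [measurable]: "Delta N \<in> sets borel" "interior (Delta N) \<in> sets borel"
  using closed_Delta by auto

lemma closed_facet: "closed (facet N l)"
proof -
  have "facet N l = Delta N \<inter> {x. l \<bullet> x = 1}" by (auto simp: facet_def)
  then show ?thesis by (simp add: closed_Delta closed_Int closed_hyperplane)
qed

lemma sets_facet [measurable]: "facet N l \<in> sets borel"
  using closed_facet by auto

lemma facet_subset: "facet N l \<subseteq> Delta N"
  by (auto simp: facet_def)

text \<open>If no normal were positive on \<open>x\<close>, the whole ray through \<open>x\<close>
  would stay in the bounded set \<Delta>; the multiple of norm \<open>2 * K\<close> already leaves
  it. A maximising normal \<open>l\<close> names the facet whose cone contains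
  \<open>x\<close>.\<close>

lemma max_normal:
  assumes "x \<noteq> 0"
  obtains l where "l \<in> N" "0 < l \<bullet> x" "\<And>l'. l' \<in> N \<Longrightarrow> l' \<bullet> x \<le> l \<bullet> x"
proof -
  have "\<exists>l\<in>N. 0 < l \<bullet> x"
  proof (rule ccontr)
    assume *: "\<not> ?thesis"
    obtain K where K: "\<And>y. y \<in> Delta N \<Longrightarrow> norm y \<le> K" "K > 0"
      using bounded_Delta by (meson bounded_pos)
    have "l \<bullet> ((2 * K / norm x) *\<^sub>R x) \<le> 1" if "l \<in> N" for l
    proof -
      have "(2 * K / norm x) * (l \<bullet> x) \<le> 0"
        using * that K(2) by (intro mult_nonneg_nonpos) (auto simp: not_less)
      then show ?thesis by simp
    qed
    then have "(2 * K / norm x) *\<^sub>R x \<in> Delta N" by (simp add: Delta_def)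
    from K(1)[OF this] K(2) assms show False by simp
  qed
  then obtain l0 where l0: "l0 \<in> N" "0 < l0 \<bullet> x" by blast
  have "Max ((\<lambda>l. l \<bullet> x) ` N) \<in> (\<lambda>l. l \<bullet> x) ` N"
    using finite_N l0 by (intro Max_in) auto
  then obtain l where l: "l \<in> N" "l \<bullet> x = Max ((\<lambda>l. l \<bullet> x) ` N)" by auto
  have "l' \<bullet> x \<le> l \<bullet> x" if "l' \<in> N" for l'
    unfolding l(2) using finite_N that by (intro Max_ge) auto
  with l0 l(1) show thesis by (intro that[of l]) (auto intro: less_le_trans)
qed

text \<open>\<open>\<Delta>\<close> is the union of the cones over its facets, which overlap in null sets only.\<close>
lemma nn_integral_Delta:
  assumes g[measurable]: "g \<in> borel_measurable borel"
  shows "(\<integral>\<^sup>+x. g x * indicator (Delta N) x \<partial>lborel) =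
    (\<Sum>l\<in>N. ennreal (1 / norm l) * (\<integral>\<^sup>+y. (\<integral>\<^sup>+t. ennreal (t ^ (CARD('n) - 1)) * g (t *\<^sub>R y) * indicator {0<..1} t \<partial>lborel)
       * indicator (facet N l) y \<partial>hyperplane_lebesgue l))"
proof -
  \<comment> \<open>Within \<open>l \<bullet> x > 0\<close> this is the part of \<Delta> on the rays
    to the facet of \<open>l\<close>. Describing it by maximality of \<open>l \<bullet> x\<close>
    makes it visibly closed and confines overlaps to the hyperplanes where two normals
    agree.\<close>
  define C where "C l = {x \<in> Delta N. \<forall>l'\<in>N. l' \<bullet> x \<le> l \<bullet> x}" for l
  have "closed (C l)" for l
  proof -
    have "C l = Delta N \<inter> (\<Inter>l'\<in>N. {x. (l' - l) \<bullet> x \<le> 0})"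
      by (auto simp: C_def inner_diff_left)
    then show ?thesis by (simp add: closed_Delta closed_Int closed_INT closed_halfspace_le)
  qed
  then have [measurable]: "C l \<in> sets borel" for l by auto
  have AE1: "AE x in lborel. \<forall>l\<in>N. \<forall>l'\<in>N. l \<noteq> l' \<longrightarrow> l \<bullet> x \<noteq> l' \<bullet> x"
  proof (intro AE_finite_allI finite_N)
    fix l l' :: "real ^ 'n"
    show "AE x in lborel. l \<noteq> l' \<longrightarrow> l \<bullet> x \<noteq> l' \<bullet> x"
    proof (cases "l = l'")
      case False
      then have "negligible {x. (l - l') \<bullet> x = 0}"
        by (intro negligible_hyperplane) auto
      moreover have "{x. (l - l') \<bullet> x = 0} \<in> sets lborel"
        using closed_hyperplane[of "l - l'" 0] by auto
      ultimately have "{x. (l - l') \<bullet> x = 0} \<in> null_sets lborel"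
        by (simp add: negligible_iff_null_sets null_sets_completion_iff)
      from AE_not_in[OF this] show ?thesis
        by eventually_elim (auto simp: inner_diff_left)
    qed simp
  qed
  have "AE x in lborel. (x :: real ^ 'n) \<noteq> 0" by (rule AE_lborel_singleton)
  with AE1 have "AE x in lborel. g x * indicator (Delta N) x
      = (\<Sum>l\<in>N. (g x * indicator (C l) x) * indicator {x. l \<bullet> x > 0} x)"
  proof eventually_elim
    case (elim x)
    obtain l where l: "l \<in> N" "0 < l \<bullet> x" "\<And>l'. l' \<in> N \<Longrightarrow> l' \<bullet> x \<le> l \<bullet> x"
      using max_normal[OF elim(2)] by metis
    have "(\<Sum>l\<in>N. (g x * indicator (C l) x) * indicator {x. l \<bullet> x > 0} x)
        = (\<Sum>l'\<in>N. if l' = l then g x * indicator (Delta N) x else 0)"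
    proof (intro sum.cong refl)
      fix l' assume l': "l' \<in> N"
      show "(g x * indicator (C l') x) * indicator {x. l' \<bullet> x > 0} x = (if l' = l then g x * indicator (Delta N) x else 0)"
      proof (cases "l' = l")
        case False
        then have "x \<notin> C l'"
          using elim(1) l(1) l(3)[OF l'] l' by (fastforce simp: C_def)
        with False show ?thesis by simp
      qed (use l in \<open>auto simp: C_def indicator_def\<close>)
    qed
    then show ?case using l(1) finite_N by simp
  qed
  then have "(\<integral>\<^sup>+x. g x * indicator (Delta N) x \<partial>lborel)
     = (\<integral>\<^sup>+x. (\<Sum>l\<in>N. (g x * indicator (C l) x) * indicator {x. l \<bullet> x > 0} x) \<partial>lborel)"
    by (rule nn_integral_cong_AE)
  also have "\<dots> = (\<Sum>l\<in>N. (\<integral>\<^sup>+x. (g x * indicator (C l) x) * indicator {x. l \<bullet> x > 0} x \<partial>lborel))"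
    by (rule nn_integral_sum) measurable
  also have "\<dots> = (\<Sum>l\<in>N. ennreal (1 / norm l) *
     (\<integral>\<^sup>+y. (\<integral>\<^sup>+t. ennreal (t ^ (CARD('n) - 1)) * g (t *\<^sub>R y) * indicator {0<..1} t \<partial>lborel)
       * indicator (facet N l) y \<partial>hyperplane_lebesgue l))"
  proof (intro sum.cong refl)
    fix l assume l: "l \<in> N"
    have "(\<integral>\<^sup>+x. (g x * indicator (C l) x) * indicator {x. l \<bullet> x > 0} x \<partial>lborel) = ennreal (1 / norm l) *
      (\<integral>\<^sup>+y. (\<integral>\<^sup>+t. ennreal (t ^ (CARD('n) - 1)) * (g (t *\<^sub>R y) * indicator (C l) (t *\<^sub>R y)) * indicator {0<..} t \<partial>lborel)
         \<partial>hyperplane_lebesgue l)"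
      using normal_nonzero[OF l] by (intro nn_integral_cone) auto
    also have "(\<integral>\<^sup>+y. (\<integral>\<^sup>+t. ennreal (t ^ (CARD('n) - 1)) * (g (t *\<^sub>R y) * indicator (C l) (t *\<^sub>R y)) * indicator {0<..} t \<partial>lborel)
         \<partial>hyperplane_lebesgue l)
       = (\<integral>\<^sup>+y. (\<integral>\<^sup>+t. ennreal (t ^ (CARD('n) - 1)) * g (t *\<^sub>R y) * indicator {0<..1} t \<partial>lborel)
       * indicator (facet N l) y \<partial>hyperplane_lebesgue l)"
    proof (rule nn_integral_cong_AE)
      show "AE y in hyperplane_lebesgue l. (\<integral>\<^sup>+t. ennreal (t ^ (CARD('n) - 1)) * (g (t *\<^sub>R y) * indicator (C l) (t *\<^sub>R y)) * indicator {0<..} t \<partial>lborel)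
        = (\<integral>\<^sup>+t. ennreal (t ^ (CARD('n) - 1)) * g (t *\<^sub>R y) * indicator {0<..1} t \<partial>lborel) * indicator (facet N l) y"
        using AE_hyperplane_lebesgue[OF normal_nonzero[OF l]]
      proof eventually_elim
        case (elim y)
        \<comment> \<open>As \<open>l \<bullet> y = 1\<close>, maximality of \<open>l\<close> at
          \<open>y\<close> says exactly that \<open>l' \<bullet> y \<le> 1\<close> for all normals,
          which is membership in \<Delta>.\<close>
        have C: "t *\<^sub>R y \<in> C l \<longleftrightarrow> t \<le> 1 \<and> y \<in> facet N l" if "t > 0" for t
        proof
          assume "t *\<^sub>R y \<in> C l"
          then show "t \<le> 1 \<and> y \<in> facet N l"
            using that l elim by (auto simp: C_def Delta_def facet_def)
        next
          assume y: "t \<le> 1 \<and> y \<in> facet N l"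
          then have *: "l' \<bullet> y \<le> 1" if "l' \<in> N" for l'
            using that by (auto simp: facet_def Delta_def)
          have "t * (l' \<bullet> y) \<le> t" if "l' \<in> N" for l'
            using mult_left_mono[OF *[OF that], of t] \<open>t > 0\<close> by simp
          then show "t *\<^sub>R y \<in> C l"
            using y elim by (fastforce simp: C_def Delta_def intro: order_trans)
        qed
        show ?case
        proof (cases "y \<in> facet N l")
          case True
          then show ?thesis by (auto intro!: nn_integral_cong simp: C indicator_def)
        next
          case False
          then have z: "ennreal (t ^ (CARD('n) - 1)) * (g (t *\<^sub>R y) * indicator (C l) (t *\<^sub>R y)) * indicator {0<..} t = 0" for t
            using C[of t] by (auto simp: indicator_def)
          show ?thesis unfolding z using False by simp
        qed
      qed
    qed
    finally show "(\<integral>\<^sup>+x. (g x * indicator (C l) x) * indicator {x. l \<bullet> x > 0} x \<partial>lborel) = ennreal (1 / norm l) *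
     (\<integral>\<^sup>+y. (\<integral>\<^sup>+t. ennreal (t ^ (CARD('n) - 1)) * g (t *\<^sub>R y) * indicator {0<..1} t \<partial>lborel)
       * indicator (facet N l) y \<partial>hyperplane_lebesgue l)" .
  qed
  finally show ?thesis .
qed

end

section \<open>Boundary integrals as integrals over \<Delta>\<close>

lemma set_lebesgue_integral_lborel:
  fixes h :: "'a::euclidean_space \<Rightarrow> real"
  assumes [measurable]: "h \<in> borel_measurable borel" "A \<in> sets borel"
  shows "(LINT x:A|lebesgue. h x) = (LINT x:A|lborel. h x)"
  unfolding set_lebesgue_integral_def by (rule integral_completion) measurable

lemma set_integrable_lborel:
  fixes h :: "'a::euclidean_space \<Rightarrow> real"
  assumes [measurable]: "h \<in> borel_measurable borel" "A \<in> sets borel"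
  shows "set_integrable lebesgue A h \<longleftrightarrow> set_integrable lborel A h"
  unfolding set_integrable_def by (rule integrable_completion) measurable

lemma boundary_integral_add:
  assumes "boundary_integrable N u" "boundary_integrable N v"
  shows "boundary_integrable N (\<lambda>x. u x + v x)"
    and "boundary_integral N (\<lambda>x. u x + v x) = boundary_integral N u + boundary_integral N v"
  using assms
  by (auto simp: boundary_integrable_def boundary_integral_def set_integral_add sum.distrib[symmetric]
      add_divide_distrib intro!: sum.cong)

lemma boundary_integral_cmult:
  assumes "boundary_integrable N u"
  shows "boundary_integrable N (\<lambda>x. k * u x)"
    and "boundary_integral N (\<lambda>x. k * u x) = k * boundary_integral N u"
  using assms
  by (auto simp: boundary_integrable_def boundary_integral_def sum_distrib_left intro!: sum.cong)

context polytope_at_unit_distance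
begin

lemma scaleR_facet_in_Delta:
  assumes "y \<in> facet N l" "0 \<le> t" "t \<le> 1"
  shows "t *\<^sub>R y \<in> Delta N"
proof -
  have "t *\<^sub>R y + (1 - t) *\<^sub>R 0 \<in> Delta N"
    using assms facet_subset[of l] zero_in_interior interior_subset[of "Delta N"]
    by (intro convexD[OF convex_Delta]) auto
  then show ?thesis by simp
qed

lemma set_integrable_Delta_bounded:
  fixes h :: "real ^ 'n \<Rightarrow> real"
  assumes [measurable]: "h \<in> borel_measurable borel" and "\<And>x. x \<in> Delta N \<Longrightarrow> \<bar>h x\<bar> \<le> K"
  shows "set_integrable lebesgue (Delta N) h"
  unfolding set_integrable_lborel[OF assms(1) sets_Delta(1)]
  unfolding set_integrable_def
proof (rule integrableI_bounded_set[of "Delta N" _ _ K])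
  show "emeasure lborel (Delta N) < \<infinity>"
    using bounded_Delta by (intro emeasure_bounded_finite)
qed (use assms(2) in \<open>auto simp: indicator_def\<close>)

lemma set_integral_Delta_const:
  "(LINT x:Delta N|lebesgue. (k::real)) = k * measure lebesgue (Delta N)"
  by (simp add: set_lebesgue_integral_def)

text \<open>The polar formula applied to \<open>h\<close>, whose ray integrals are \<open>u\<close>
  by assumption. For \<open>h \<ge> 0\<close> everything stays within nonnegative integrals, and
  integrability of \<open>u\<close> on each facet results from the finiteness of the total.\<close>

lemma boundary_integral_nonneg_eq:
  assumes u[measurable]: "u \<in> borel_measurable borel" and h[measurable]: "h \<in> borel_measurable borel"
    and bound: "\<And>x. x \<in> Delta N \<Longrightarrow> 0 \<le> h x \<and> h x \<le> K"
    and ray: "\<And>l y. l \<in> N \<Longrightarrow> y \<in> facet N l \<Longrightarrow>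
      ((\<lambda>t. t ^ (CARD('n) - 1) * h (t *\<^sub>R y)) has_integral u y) {0..1}"
  shows "boundary_integrable N u \<and> boundary_integral N u = (LINT x:Delta N|lebesgue. h x)"
proof -
  let ?I = "\<lambda>l. \<integral>\<^sup>+y. ennreal (u y * indicator (facet N l) y) \<partial>hyperplane_lebesgue l"
  have int_h: "set_integrable lebesgue (Delta N) h"
    using bound by (intro set_integrable_Delta_bounded[of _ K]) auto
  have u_nonneg: "0 \<le> u y" if "l \<in> N" "y \<in> facet N l" for l y
    using ray[OF that] by (rule has_integral_nonneg) (use bound scaleR_facet_in_Delta[OF that(2)] in auto)
  have "(\<integral>\<^sup>+x. ennreal (h x * indicator (Delta N) x) \<partial>lborel) = (\<integral>\<^sup>+x. ennreal (h x) * indicator (Delta N) x \<partial>lborel)"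
    by (intro nn_integral_cong) (auto simp: indicator_def)
  also have "\<dots> =
    (\<Sum>l\<in>N. ennreal (1 / norm l) * (\<integral>\<^sup>+y. (\<integral>\<^sup>+t. ennreal (t ^ (CARD('n) - 1)) * ennreal (h (t *\<^sub>R y)) * indicator {0<..1} t \<partial>lborel)
       * indicator (facet N l) y \<partial>hyperplane_lebesgue l))"
    by (rule nn_integral_Delta) measurable
  also have "\<dots> = (\<Sum>l\<in>N. ennreal (1 / norm l) * ?I l)"
  proof (intro sum.cong refl arg_cong2[where f = times] nn_integral_cong)
    fix l y assume l: "l \<in> N"
    show "(\<integral>\<^sup>+t. ennreal (t ^ (CARD('n) - 1)) * ennreal (h (t *\<^sub>R y)) * indicator {0<..1} t \<partial>lborel) * indicator (facet N l) y
        = ennreal (u y * indicator (facet N l) y)"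
    proof (cases "y \<in> facet N l")
      case True
      have "(\<integral>\<^sup>+t. ennreal (t ^ (CARD('n) - 1)) * ennreal (h (t *\<^sub>R y)) * indicator {0<..1} t \<partial>lborel)
          = (\<integral>\<^sup>+t. ennreal (t ^ (CARD('n) - 1) * h (t *\<^sub>R y)) * indicator {0..1} t \<partial>lborel)"
      proof (rule nn_integral_cong_AE)
        \<comment> \<open>The two sides can differ at t = 0 when n = 1, since then the power of 0 is
          1.\<close>
        show "AE t in lborel. ennreal (t ^ (CARD('n) - 1)) * ennreal (h (t *\<^sub>R y)) * indicator {0<..1} t
          = ennreal (t ^ (CARD('n) - 1) * h (t *\<^sub>R y)) * indicator {0..1} t"
          using AE_lborel_singleton[of "0::real"]
          by eventually_elim (use bound scaleR_facet_in_Delta[OF True] in \<open>auto simp: indicator_def ennreal_mult\<close>)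
      qed
      also have "\<dots> = ennreal (u y)"
        using bound scaleR_facet_in_Delta[OF True]
        by (intro nn_integral_has_integral_lebesgue' ray[OF l True]) auto
      finally show ?thesis using True by simp
    qed simp
  qed
  finally have eq: "(\<integral>\<^sup>+x. ennreal (h x * indicator (Delta N) x) \<partial>lborel) = (\<Sum>l\<in>N. ennreal (1 / norm l) * ?I l)" .
  have fin_h: "(\<integral>\<^sup>+x. ennreal (h x * indicator (Delta N) x) \<partial>lborel) < \<infinity>"
    using int_h bound unfolding set_integrable_lborel[OF h sets_Delta(1)]
    unfolding set_integrable_def
    by (subst nn_integral_eq_integral) (auto simp: mult.commute indicator_def)
  have lfin: "\<forall>l\<in>N. ennreal (1 / norm l) * ?I l < top"
  proof
    fix l assume "l \<in> N"
    then have "ennreal (1 / norm l) * ?I l \<le> (\<Sum>l\<in>N. ennreal (1 / norm l) * ?I l)"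
      using finite_N by (intro member_le_sum) auto
    also have "\<dots> < top" using fin_h eq by simp
    finally show "ennreal (1 / norm l) * ?I l < top" .
  qed
  have fin: "?I l < \<infinity>" if "l \<in> N" for l
    using lfin that normal_nonzero[OF that] by (auto simp: ennreal_mult_less_top)
  have meas: "(\<lambda>y. u y * indicator (facet N l) y) \<in> borel_measurable (hyperplane_lebesgue l)" if "l \<in> N" for l
    using normal_nonzero[OF that] by (intro borel_measurable_hyperplane_lebesgue) auto
  have nn: "0 \<le> u y * indicator (facet N l) y" if "l \<in> N" for l y
    using u_nonneg[OF that] by (auto simp: indicator_def)
  have "boundary_integrable N u"
    unfolding boundary_integrable_def set_integrable_def
    using meas nn fin by (auto simp: integrable_iff_bounded mult.commute)
  moreover have "boundary_integral N u = (\<Sum>l\<in>N. enn2real (ennreal (1 / norm l) * ?I l))"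
    unfolding boundary_integral_def set_lebesgue_integral_def
    using meas nn by (intro sum.cong refl) (auto simp: integral_eq_nn_integral mult.commute enn2real_mult)
  moreover have "\<dots> = enn2real (\<integral>\<^sup>+x. ennreal (h x * indicator (Delta N) x) \<partial>lborel)"
    unfolding eq using lfin by (subst enn2real_sum) (auto simp: comp_def)
  moreover have "\<dots> = (LINT x:Delta N|lborel. h x)"
    unfolding set_lebesgue_integral_def using bound
    by (subst integral_eq_nn_integral) (auto simp: mult.commute indicator_def)
  ultimately show ?thesis
    by (simp add: set_lebesgue_integral_lborel)
qed

text \<open>The choice of \<open>h\<close> constantly n works because n t^(n-1) integrates to 1 over
  [0, 1].\<close>

lemma boundary_integrable_const_and_integral:
  "boundary_integrable N (\<lambda>_. 1) \<and> boundary_integral N (\<lambda>_. 1) = real CARD('n) * measure lebesgue (Delta N)"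
proof -
  have "real (CARD('n) - 1) + 1 = real CARD('n)" by (simp add: of_nat_diff Suc_leI)
  then have "((\<lambda>t. t ^ (CARD('n) - 1) * real CARD('n)) has_integral 1) {0..1::real}"
    using has_integral_mult_left[OF ray_integral_power[of "CARD('n) - 1"], of "real CARD('n)"] by simp
  then have "boundary_integrable N (\<lambda>_. 1) \<and> boundary_integral N (\<lambda>_. 1) = (LINT x:Delta N|lebesgue. real CARD('n))"
    by (intro boundary_integral_nonneg_eq[where K = "real CARD('n)"]) auto
  then show ?thesis by (simp add: set_integral_Delta_const)
qed

text \<open>
  This is the divergence theorem for the field \<open>x \<mapsto> u(x) x\<close>, with \<open>h = n u + \<langle>x, \<nabla>u\<rangle>\<close>:
  every facet has height \<open>1 / |l|\<close> over the origin, so \<open>d\<sigma>\<close> is the flux of \<open>x\<close>.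
\<close>
lemma boundary_integral_eq:
  assumes u[measurable]: "u \<in> borel_measurable borel" and h[measurable]: "h \<in> borel_measurable borel"
    and bound: "\<And>x. x \<in> Delta N \<Longrightarrow> \<bar>h x\<bar> \<le> K"
    and ray: "\<And>l y. l \<in> N \<Longrightarrow> y \<in> facet N l \<Longrightarrow>
      ((\<lambda>t. t ^ (CARD('n) - 1) * h (t *\<^sub>R y)) has_integral u y) {0..1}"
  shows "boundary_integrable N u" "boundary_integral N u = (LINT x:Delta N|lebesgue. h x)"
proof -
  let ?n = "real CARD('n)"
  have n: "real (CARD('n) - 1) + 1 = ?n" by (simp add: of_nat_diff Suc_leI)
  \<comment> \<open>Adding \<open>K\<close> to \<open>h\<close> makes it nonnegative and bounded by
    \<open>2 * K\<close>; along a ray the added constant contributes \<open>K / ?n\<close>.\<close>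
  have shift: "boundary_integrable N (\<lambda>x. u x + K / ?n) \<and>
    boundary_integral N (\<lambda>x. u x + K / ?n) = (LINT x:Delta N|lebesgue. h x + K)"
  proof (rule boundary_integral_nonneg_eq[where K = "2 * K"])
    fix l y assume "l \<in> N" "y \<in> facet N l"
    from has_integral_add[OF ray[OF this] has_integral_mult_left[OF ray_integral_power[of "CARD('n) - 1"], of K]]
    show "((\<lambda>t. t ^ (CARD('n) - 1) * (h (t *\<^sub>R y) + K)) has_integral (u y + K / ?n)) {0..1}"
      by (simp add: n distrib_left)
  qed (use bound in \<open>auto simp: abs_le_iff\<close>, fastforce+)
  note c = boundary_integrable_const_and_integral
  show "boundary_integrable N u"
    using boundary_integral_add(1)[OF conjunct1[OF shift] boundary_integral_cmult(1)[OF conjunct1[OF c], of "- K / ?n"]]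
    by simp
  have "boundary_integral N u = boundary_integral N (\<lambda>x. u x + K / ?n) + (- K / ?n) * boundary_integral N (\<lambda>_. 1)"
    using boundary_integral_add(2)[OF conjunct1[OF shift] boundary_integral_cmult(1)[OF conjunct1[OF c], of "- K / ?n"]]
      boundary_integral_cmult(2)[OF conjunct1[OF c], of "- K / ?n"]
    by simp
  also have "\<dots> = (LINT x:Delta N|lebesgue. h x)"
    using shift c set_integrable_Delta_bounded[OF h bound] set_integrable_Delta_bounded[of "\<lambda>_. K" "\<bar>K\<bar>"]
    by (simp add: set_integral_add set_integral_Delta_const)
  finally show "boundary_integral N u = (LINT x:Delta N|lebesgue. h x)" .
qed

end

section \<open>Affine functions and the extremal potential\<close>

lemma affine_linear_iff: "affine_linear f \<longleftrightarrow> (\<exists>p. f = (\<lambda>x. p \<bullet> (x, 1 :: real)))"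
  unfolding affine_linear_def by (simp add: split_paired_Ex inner_real_def)

text \<open>The integrand is the derivative of t^n (t s + c): for an affine function on the ray
  through y, s is its linear part at y.\<close>

lemma has_integral_ray_affine:
  assumes "k + 1 = n"
  shows "((\<lambda>t. t ^ k * (real n * (t * s + c) + t * s)) has_integral (s + c)) {0..1::real}"
proof -
  have n: "real n > 0" "real k + 1 = real n" using assms by auto
  have "((\<lambda>t. t ^ Suc k * ((real n + 1) * s) + t ^ k * (real n * c)) has_integral
      (1 / (real (Suc k) + 1) * ((real n + 1) * s) + 1 / (real k + 1) * (real n * c))) {0..1::real}"
    by (intro has_integral_add has_integral_mult_left ray_integral_power)
  also have "(\<lambda>t. t ^ Suc k * ((real n + 1) * s) + t ^ k * (real n * c)) = (\<lambda>t. t ^ k * (real n * (t * s + c) + t * s))"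
    by (simp add: fun_eq_iff algebra_simps)
  also have "1 / (real (Suc k) + 1) * ((real n + 1) * s) + 1 / (real k + 1) * (real n * c) = s + c"
  proof -
    have "real (Suc k) = real n" using assms by simp
    then show ?thesis using n by (simp only: n(2)) (simp add: field_simps)
  qed
  finally show ?thesis .
qed

context polytope_at_unit_distance
begin

lemma set_integrable_Delta_continuous:
  fixes h :: "real ^ 'n \<Rightarrow> 'b::euclidean_space"
  assumes "continuous_on UNIV h"
  shows "set_integrable lebesgue (Delta N) h"
proof -
  have "integrable lborel (\<lambda>x. indicator (Delta N) x *\<^sub>R h x)"
    using compact_Delta assms continuous_on_subset by (intro borel_integrable_compact) blast+
  then show ?thesis
    unfolding set_integrable_def using borel_measurable_integrable
    by (subst integrable_completion) auto
qed

lemma continuous_bounded_on_Delta: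
  fixes h :: "real ^ 'n \<Rightarrow> real"
  assumes "continuous_on UNIV h"
  obtains K where "\<And>x. x \<in> Delta N \<Longrightarrow> \<bar>h x\<bar> \<le> K"
proof -
  have "bounded (h ` Delta N)"
    using assms compact_Delta by (intro compact_imp_bounded compact_continuous_image) (auto intro: continuous_on_subset)
  then show thesis using that by (auto simp: bounded_iff)
qed

lemma boundary_integrable_affine:
  assumes "affine_linear f"
  shows "boundary_integrable N f"
proof -
  obtain a c where f: "f = (\<lambda>x. a \<bullet> x + c)" using assms by (auto simp: affine_linear_def)
  let ?h = "\<lambda>x. real CARD('n) * (a \<bullet> x + c) + a \<bullet> x"
  have cont: "continuous_on UNIV ?h" by (intro continuous_intros)
  obtain K where K: "\<And>x. x \<in> Delta N \<Longrightarrow> \<bar>?h x\<bar> \<le> K"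
    using continuous_bounded_on_Delta[OF cont] by blast
  show ?thesis
  proof (rule boundary_integral_eq(1))
    fix y :: "real ^ 'n"
    have "CARD('n) - 1 + 1 = CARD('n)" by simp
    from has_integral_ray_affine[OF this, of "a \<bullet> y" c]
    show "((\<lambda>t. t ^ (CARD('n) - 1) * ?h (t *\<^sub>R y)) has_integral f y) {0..1}"
      by (simp add: f)
  qed (use K in \<open>auto simp: f\<close>)
qed

text \<open>A nonempty open set is not null. Density is all that an almost-everywhere statement
  gives; closedness or convexity of the set where \<open>Q\<close> holds then removes the
  closure.\<close>

lemma interior_Delta_subset_closure_AE:
  assumes "AE x in lebesgue. x \<in> Delta N \<longrightarrow> Q x"
  shows "interior (Delta N) \<subseteq> closure {x \<in> interior (Delta N). Q x}"
proof (rule ccontr)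
  let ?U = "interior (Delta N) - closure {x \<in> interior (Delta N). Q x}"
  assume "\<not> ?thesis"
  then have U: "open ?U" "?U \<noteq> {}" by auto
  obtain Z where Z: "Z \<in> null_sets lebesgue" "\<And>x. x \<notin> Z \<Longrightarrow> x \<in> Delta N \<longrightarrow> Q x"
    using assms by (auto elim!: AE_E3)
  have "?U \<subseteq> Z"
    using Z(2) interior_subset[of "Delta N"] closure_subset[of "{x \<in> interior (Delta N). Q x}"] by blast
  then have "negligible ?U"
    using Z(1) negligible_subset by (auto simp: negligible_iff_null_sets)
  with U show False using open_not_negligible by blast
qed

lemma affine_zero_on_interior:
  assumes "\<And>x. x \<in> interior (Delta N) \<Longrightarrow> p \<bullet> (x, 1) = 0"
  shows "p = (0 :: (real ^ 'n) \<times> real)"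
proof -
  obtain a c where p: "p = (a, c)" by (cases p)
  have c: "c = 0" using assms[OF zero_in_interior] by (simp add: p)
  obtain e where e: "e > 0" "ball 0 e \<subseteq> interior (Delta N)"
    using zero_in_interior open_contains_ball[of "interior (Delta N)"] by auto
  have "a = 0"
  proof (rule ccontr)
    assume a: "a \<noteq> 0"
    have "(e / (2 * norm a)) *\<^sub>R a \<in> ball 0 e" using a e(1) by simp
    then have "p \<bullet> ((e / (2 * norm a)) *\<^sub>R a, 1) = 0" using e(2) assms by blast
    then show False using a e(1) by (simp add: p c)
  qed
  with c show ?thesis by (simp add: p zero_prod_def)
qed

text \<open>
  The \<open>L\<^sup>2(\<Delta>)\<close> Gram form on affine functions is positive definite, so every linear functional on
  them, in particular \<open>u \<mapsto> \<integral>\<^bsub>\<partial>\<Delta>\<^esub> u d\<sigma> - S \<integral>\<^bsub>\<Delta>\<^esub> u dx\<close>, is represented by exactly one affine \<open>\<theta>\<close>.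
\<close>
lemma ex1_extremal_potential:
  "\<exists>!\<theta>. affine_linear \<theta> \<and> (\<forall>u. affine_linear u \<longrightarrow> stability_functional N \<theta> u = 0)"
proof -
  \<comment> \<open>In homogeneous coordinates an affine function is
    \<open>p \<bullet> (x, 1)\<close>, so affine functions form a Euclidean space. There
    \<open>T\<close> is the Gram operator and \<phi> the functional to be represented.\<close>
  let ?P = "\<lambda>x :: real ^ 'n. (x, 1 :: real)" and ?S = "avg_scalar_curvature N"
  define T where "T p = (LINT x:Delta N|lebesgue. (p \<bullet> ?P x) *\<^sub>R ?P x)" for p
  define \<phi> where "\<phi> q = boundary_integral N (\<lambda>x. q \<bullet> ?P x) - (LINT x:Delta N|lebesgue. ?S * (q \<bullet> ?P x))" for q
  have T_int: "set_integrable lebesgue (Delta N) (\<lambda>x. (p \<bullet> ?P x) *\<^sub>R ?P x)" for p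
    by (intro set_integrable_Delta_continuous continuous_intros)
  have inner_T: "q \<bullet> T p = (LINT x:Delta N|lebesgue. (p \<bullet> ?P x) * (q \<bullet> ?P x))" for p q
    using T_int[of p] unfolding T_def set_lebesgue_integral_def set_integrable_def
    by (subst integral_inner_right[symmetric]) (simp_all add: mult.assoc del: inner_Pair scaleR_Pair)
  have linT: "linear T"
    by (rule linearI)
       (use T_int in \<open>auto simp: T_def inner_add_left scaleR_add_left set_integral_add(2)
          simp del: inner_Pair scaleR_Pair set_integral_scaleR_right simp flip: scaleR_scaleR set_integral_scaleR_right\<close>)
  have injT: "p = 0" if "T p = 0" for p
  proof (rule affine_zero_on_interior)
    have int: "set_integrable lebesgue (Delta N) (\<lambda>x. (p \<bullet> ?P x) * (p \<bullet> ?P x))"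
      by (intro set_integrable_Delta_continuous continuous_intros)
    have "(LINT x:Delta N|lebesgue. (p \<bullet> ?P x) * (p \<bullet> ?P x)) = 0"
      using inner_T[of p p] that by simp
    then have "AE x in lebesgue. indicator (Delta N) x *\<^sub>R ((p \<bullet> ?P x) * (p \<bullet> ?P x)) = 0"
      using int unfolding set_lebesgue_integral_def set_integrable_def
      by (subst (asm) integral_nonneg_eq_0_iff_AE) auto
    then have "AE x in lebesgue. x \<in> Delta N \<longrightarrow> p \<bullet> ?P x = 0"
      by eventually_elim (auto simp: indicator_def)
    from interior_Delta_subset_closure_AE[OF this]
    have "interior (Delta N) \<subseteq> closure {x. p \<bullet> ?P x = 0}"
      by (rule order_trans) (intro closure_mono, auto)
    moreover have "closed {x. p \<bullet> ?P x = 0}"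
      by (intro closed_Collect_eq continuous_intros)
    ultimately show "p \<bullet> ?P x = 0" if "x \<in> interior (Delta N)" for x
      using that by auto
  qed
  have "surj T"
    using linT injT by (intro linear_injective_imp_surjective) (auto simp: linear_injective_0)
  have aff: "affine_linear (\<lambda>x. q \<bullet> ?P x)" for q
    unfolding affine_linear_iff by blast
  have "linear \<phi>"
  proof (rule linearI)
    fix q r :: "(real ^ 'n) \<times> real" and k :: real
    have i: "set_integrable lebesgue (Delta N) (\<lambda>x. ?S * (q \<bullet> ?P x))" for q
      by (intro set_integrable_Delta_continuous continuous_intros)
    show "\<phi> (q + r) = \<phi> q + \<phi> r"
      using set_integral_add(2)[OF i[of q] i[of r]] boundary_integral_add(2)[OF boundary_integrable_affine[OF aff[of q]] boundary_integrable_affine[OF aff[of r]]]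
      unfolding \<phi>_def inner_add_left distrib_left by simp
    have "(LINT x:Delta N|lebesgue. ?S * (k * (q \<bullet> ?P x))) = k * (LINT x:Delta N|lebesgue. ?S * (q \<bullet> ?P x))"
      by (subst set_integral_mult_right[symmetric]) (simp add: mult.left_commute)
    then show "\<phi> (k *\<^sub>R q) = k *\<^sub>R \<phi> q"
      using boundary_integral_cmult(2)[OF boundary_integrable_affine[OF aff[of q]], of k]
      unfolding \<phi>_def inner_scaleR_left by (simp add: right_diff_distrib)
  qed
  \<comment> \<open>\<open>adjoint \<phi> 1\<close> is the Riesz vector of \<phi>.\<close>
  then have \<phi>: "\<phi> q = q \<bullet> adjoint \<phi> 1" for q
    using adjoint_works[of \<phi> q 1] by simp
  \<comment> \<open>The condition on \<theta> thereby becomes the linear equation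
    \<open>T p = adjoint \<phi> 1\<close>.\<close>
  have stab: "stability_functional N (\<lambda>x. p \<bullet> ?P x) (\<lambda>x. q \<bullet> ?P x) = q \<bullet> (adjoint \<phi> 1 - T p)" for p q
  proof -
    have "set_integrable lebesgue (Delta N) (\<lambda>x. ?S * (q \<bullet> ?P x))"
      "set_integrable lebesgue (Delta N) (\<lambda>x. (p \<bullet> ?P x) * (q \<bullet> ?P x))"
      by (intro set_integrable_Delta_continuous continuous_intros)+
    from set_integral_add(2)[OF this] show ?thesis
      unfolding stability_functional_def inner_diff_right \<phi>[symmetric] inner_T
      by (simp add: \<phi>_def distrib_right del: inner_Pair)
  qed
  have iff: "(\<forall>u. affine_linear u \<longrightarrow> stability_functional N (\<lambda>x. p \<bullet> ?P x) u = 0) \<longleftrightarrow> T p = adjoint \<phi> 1" for p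
  proof
    assume "\<forall>u. affine_linear u \<longrightarrow> stability_functional N (\<lambda>x. p \<bullet> ?P x) u = 0"
    then have "(adjoint \<phi> 1 - T p) \<bullet> (adjoint \<phi> 1 - T p) = 0"
      using stab[of p "adjoint \<phi> 1 - T p"] aff by simp
    then show "T p = adjoint \<phi> 1" by simp
  next
    assume "T p = adjoint \<phi> 1"
    then show "\<forall>u. affine_linear u \<longrightarrow> stability_functional N (\<lambda>x. p \<bullet> ?P x) u = 0"
      unfolding affine_linear_iff using stab[of p] by fastforce
  qed
  obtain p where p: "T p = adjoint \<phi> 1"
    using \<open>surj T\<close> by (metis surjD)
  show ?thesis
  proof (rule ex1I[of _ "\<lambda>x. p \<bullet> ?P x"])
    show "affine_linear (\<lambda>x. p \<bullet> ?P x) \<and> (\<forall>u. affine_linear u \<longrightarrow> stability_functional N (\<lambda>x. p \<bullet> ?P x) u = 0)"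
      using aff iff p by blast
    fix \<theta> assume \<theta>: "affine_linear \<theta> \<and> (\<forall>u. affine_linear u \<longrightarrow> stability_functional N \<theta> u = 0)"
    then obtain p' where p': "\<theta> = (\<lambda>x. p' \<bullet> ?P x)"
      unfolding affine_linear_iff by blast
    then have "T p' = T p" using \<theta> iff p by simp
    then have "T (p' - p) = 0" using linT by (simp add: linear_diff)
    then show "\<theta> = (\<lambda>x. p \<bullet> ?P x)" using injT p' by fastforce
  qed
qed

lemma affine_extremal_potential: "affine_linear (extremal_potential N)"
  and L_Delta_affine: "affine_linear u \<Longrightarrow> L_Delta N u = 0"
  using theI'[OF ex1_extremal_potential] unfolding extremal_potential_def L_Delta_def by blast+

end

section \<open>The destabilizing piecewise linear function\<close>

lemma has_integral_ray_positive_part: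
  assumes n: "k + 1 = n"
  shows "((\<lambda>t. t ^ k * (real n * max 0 (t * s + d) + (if t * s + d > 0 then t * s else 0))) has_integral max 0 (s + d)) {0..1::real}"
proof (cases "s = 0")
  case True
  have "real k + 1 = real n" "n > 0" using n by auto
  then show ?thesis
    using has_integral_mult_left[OF ray_integral_power[of k], of "real n * max 0 d"] True
    by (simp cong: if_cong)
next
  case False
  \<comment> \<open>A primitive of the integrand away from the kink \<open>- d / s\<close>. Being
    continuous, it still qualifies for the fundamental theorem with that one point excepted.\<close>
  let ?F = "\<lambda>t. t ^ n * max 0 (t * s + d)"
  have "((\<lambda>t. t ^ k * (real n * max 0 (t * s + d) + (if t * s + d > 0 then t * s else 0))) has_integral (?F 1 - ?F 0)) {0..1}"
  proof (rule fundamental_theorem_of_calculus_interior_strong[where S = "{- d / s}"])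
    fix t :: real assume t: "t \<in> {0<..<1} - {- d / s}"
    then have ne: "t * s + d \<noteq> 0" using False by (auto simp: field_simps)
    have tn: "t ^ n = t * t ^ k" "t ^ (n - Suc 0) = t ^ k" using n by auto
    have "(?F has_real_derivative t ^ k * (real n * max 0 (t * s + d) + (if t * s + d > 0 then t * s else 0))) (at t)"
    proof (cases "t * s + d > 0")
      case True
      have "((\<lambda>t. t ^ n * (t * s + d)) has_real_derivative t ^ k * (real n * max 0 (t * s + d) + (if t * s + d > 0 then t * s else 0))) (at t)"
        using True by (auto intro!: derivative_eq_intros simp: tn algebra_simps)
      moreover have "open {t. 0 < t * s + d}"
        by (intro open_Collect_less continuous_intros)
      ultimately show ?thesis
        using True by (elim has_field_derivative_transform_within_open) auto
    next
      case False
      have "((\<lambda>_. 0) has_real_derivative t ^ k * (real n * max 0 (t * s + d) + (if t * s + d > 0 then t * s else 0))) (at t)"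
        using False by auto
      moreover have "open {t. t * s + d < 0}"
        by (intro open_Collect_less continuous_intros)
      ultimately show ?thesis
        using False ne by (elim has_field_derivative_transform_within_open) auto
    qed
    then show "(?F has_vector_derivative t ^ k * (real n * max 0 (t * s + d) + (if t * s + d > 0 then t * s else 0))) (at t)"
      by (simp add: has_real_derivative_iff_has_vector_derivative)
  qed (auto intro!: continuous_intros)
  then show ?thesis using n by (simp add: power_0_left)
qed

context polytope_at_unit_distance
begin

lemma measure_Delta_pos: "measure lebesgue (Delta N) > 0"
proof -
  have "\<not> negligible (Delta N)"
    using open_not_negligible[of "interior (Delta N)"] zero_in_interior negligible_subset[OF _ interior_subset] by blast
  moreover have "Delta N \<in> lmeasurable"
    using compact_Delta by (rule lmeasurable_compact)
  ultimately show ?thesis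
    by (simp add: negligible_iff_measure less_le)
qed

lemma avg_scalar_curvature_eq: "avg_scalar_curvature N = real CARD('n)"
  using boundary_integrable_const_and_integral measure_Delta_pos
  by (simp add: avg_scalar_curvature_def)

lemma L_Delta_eq:
  "L_Delta N u = boundary_integral N u - (LINT x:Delta N|lebesgue. (real CARD('n) + extremal_potential N x) * u x)"
  by (simp add: L_Delta_def stability_functional_def avg_scalar_curvature_eq)

lemma Delta_minus_affine:
  assumes "extremal_potential N = (\<lambda>x. a \<bullet> x + c)"
  shows "Delta_minus N = Delta N \<inter> {x. a \<bullet> x + c > 1}"
  using assms by (auto simp: Delta_minus_def)

text \<open>On \<open>Delta_minus N\<close> the gradient of the function is \<open>a\<close>, and
  \<open>a \<bullet> x\<close> is \<theta> - c. This is where c enters: the integrand is \<theta> -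
  c - \<theta> (\<theta> - 1), which equals 1 - c - (1 - \<theta>)^2.\<close>

lemma L_Delta_positive_part:
  assumes \<theta>: "extremal_potential N = (\<lambda>x. a \<bullet> x + c)"
  shows "L_Delta N (\<lambda>x. max 0 (a \<bullet> x + (c - 1))) =
    (1 - c) * measure lebesgue (Delta_minus N) - (LINT x:Delta_minus N|lebesgue. (1 - extremal_potential N x)\<^sup>2)"
proof -
  let ?n = "real CARD('n)" and ?D = "Delta_minus N"
  define u where "u x = max 0 (a \<bullet> x + (c - 1))" for x :: "real ^ 'n"
  define h where "h x = ?n * u x + (if a \<bullet> x + (c - 1) > 0 then a \<bullet> x else 0)" for x :: "real ^ 'n"
  have [measurable]: "u \<in> borel_measurable borel" "h \<in> borel_measurable borel"
    unfolding h_def u_def by measurable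
  have "continuous_on UNIV (\<lambda>x. \<bar>?n * u x\<bar> + \<bar>a \<bullet> x\<bar>)"
    unfolding u_def by (intro continuous_intros)
  then obtain K where K: "\<And>x. x \<in> Delta N \<Longrightarrow> \<bar>\<bar>?n * u x\<bar> + \<bar>a \<bullet> x\<bar>\<bar> \<le> K"
    using continuous_bounded_on_Delta by blast
  have hK: "\<bar>h x\<bar> \<le> K" if "x \<in> Delta N" for x
    using K[OF that] unfolding h_def by (auto split: if_splits)
  have bd: "boundary_integral N u = (LINT x:Delta N|lebesgue. h x)"
  proof (rule boundary_integral_eq(2)[OF _ _ hK])
    fix y :: "real ^ 'n"
    have "CARD('n) - 1 + 1 = CARD('n)" by simp
    from has_integral_ray_positive_part[OF this, of "a \<bullet> y" "c - 1"]
    show "((\<lambda>t. t ^ (CARD('n) - 1) * h (t *\<^sub>R y)) has_integral u y) {0..1}"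
      by (simp add: h_def u_def cong: if_cong)
  qed auto
  have int_h: "set_integrable lebesgue (Delta N) h"
    by (rule set_integrable_Delta_bounded[OF _ hK]) auto
  have int_u: "set_integrable lebesgue (Delta N) (\<lambda>x. (?n + extremal_potential N x) * u x)"
    unfolding \<theta> u_def by (intro set_integrable_Delta_continuous continuous_intros)
  have meas: "?D \<in> sets borel"
    unfolding Delta_minus_affine[OF \<theta>] by (auto intro!: borel_open open_Collect_less continuous_intros)
  then have measL: "?D \<in> sets lebesgue" by simp
  have int_D: "set_integrable lebesgue ?D f" if "continuous_on UNIV f" for f :: "real ^ 'n \<Rightarrow> real"
    using measL by (rule set_integrable_subset[OF set_integrable_Delta_continuous[OF that]]) (auto simp: Delta_minus_def)
  have "L_Delta N u = (LINT x:Delta N|lebesgue. h x - (?n + extremal_potential N x) * u x)"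
    unfolding L_Delta_eq bd by (rule set_integral_diff(2)[OF int_h int_u, symmetric])
  also have "\<dots> = (LINT x:?D|lebesgue. (1 - c) - (1 - extremal_potential N x)\<^sup>2)"
    unfolding set_lebesgue_integral_def Delta_minus_affine[OF \<theta>]
    by (intro Bochner_Integration.integral_cong refl)
       (auto simp: indicator_def h_def u_def \<theta> power2_eq_square algebra_simps max_def)
  also have "\<dots> = (LINT x:?D|lebesgue. 1 - c) - (LINT x:?D|lebesgue. (1 - extremal_potential N x)\<^sup>2)"
    unfolding \<theta> by (intro set_integral_diff(2) int_D continuous_intros)
  also have "(LINT x:?D|lebesgue. 1 - c) = (1 - c) * measure lebesgue ?D"
    by (simp add: set_lebesgue_integral_def)
  finally show ?thesis by (simp add: u_def)
qed

text \<open>A nonempty interior makes the volume of \<open>Delta_minus N\<close> positive, so the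
  hypothesis may be multiplied out; it then says that the value in
  \<open>L_Delta_positive_part\<close> is negative.\<close>

lemma exists_destabilizing:
  assumes \<theta>: "extremal_potential N = (\<lambda>x. a \<bullet> x + c)"
    and "interior (Delta_minus N) \<noteq> {}"
    and less: "1 - c < (LINT x:Delta_minus N|lebesgue. (1 - extremal_potential N x)\<^sup>2) / measure lebesgue (Delta_minus N)"
  shows "\<exists>u. simple_piecewise_linear u \<and> L_Delta N u < 0"
proof (intro exI conjI)
  have "\<not> negligible (Delta_minus N)"
    using open_not_negligible[of "interior (Delta_minus N)"] assms(2) negligible_subset[OF _ interior_subset] by blast
  moreover have "Delta_minus N \<in> lmeasurable"
    using bounded_Delta unfolding Delta_minus_affine[OF \<theta>]
    by (intro bounded_set_imp_lmeasurable) (auto intro!: sets.Int borel_open open_Collect_less continuous_intros)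
  ultimately have "measure lebesgue (Delta_minus N) > 0"
    by (simp add: negligible_iff_measure less_le)
  then show "L_Delta N (\<lambda>x. max 0 (a \<bullet> x + (c - 1))) < 0"
    using less unfolding L_Delta_positive_part[OF \<theta>] by (simp add: pos_less_divide_eq)
  show "simple_piecewise_linear (\<lambda>x. max 0 (a \<bullet> x + (c - 1)))"
    by (auto simp: simple_piecewise_linear_def affine_linear_def)
qed

text \<open>\<Delta> is the closure of its interior, so the open half-space \<theta> > 1 cannot meet
  \<Delta> without meeting its interior.\<close>

lemma interior_Delta_minus_empty_iff:
  assumes \<theta>: "extremal_potential N = (\<lambda>x. a \<bullet> x + c)"
  shows "interior (Delta_minus N) = {} \<longleftrightarrow> (\<forall>x\<in>Delta N. extremal_potential N x \<le> 1)"
proof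
  assume emp: "interior (Delta_minus N) = {}"
  let ?U = "{x. a \<bullet> x + c > 1}"
  have "open ?U" by (intro open_Collect_less continuous_intros)
  then have "interior (Delta_minus N) = interior (Delta N) \<inter> ?U"
    unfolding Delta_minus_affine[OF \<theta>] by (simp add: interior_open)
  then have "?U \<inter> closure (interior (Delta N)) = {}"
    using emp open_Int_closure_eq_empty[OF \<open>open ?U\<close>] by (metis inf_commute)
  then show "\<forall>x\<in>Delta N. extremal_potential N x \<le> 1"
    unfolding closure_interior_Delta by (force simp: \<theta>)
next
  assume "\<forall>x\<in>Delta N. extremal_potential N x \<le> 1"
  then have "Delta_minus N = {}" by (auto simp: Delta_minus_def)
  then show "interior (Delta_minus N) = {}" by simp
qed


section \<open>Facets and the set \<Delta>*\<close>

lemma facet_of_Delta: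
  assumes "F facet_of Delta N"
  obtains l where "l \<in> N" "F = facet N l"
proof -
  have F: "F face_of Delta N" "F \<noteq> {}" "aff_dim F = aff_dim (Delta N) - 1"
    using assms by (auto simp: facet_of_def)
  then have "convex F" "F \<noteq> Delta N" "F \<subseteq> Delta N"
    by (auto simp: face_of_imp_convex face_of_imp_subset)
  \<comment> \<open>A single relative interior point of \<open>F\<close> decides: it is not interior
    to \<Delta>, hence lies on some \<open>facet N l\<close>, and a face containing it contains
    \<open>F\<close>. Equal dimensions force equality.\<close>
  then obtain x where x: "x \<in> rel_interior F"
    using F(2) rel_interior_eq_empty by blast
  then have "x \<in> F" using rel_interior_subset by blast
  then have "x \<notin> interior (Delta N)"
    using face_of_disjoint_interior[OF F(1) \<open>F \<noteq> Delta N\<close>] by blast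
  then obtain l where l: "l \<in> N" "1 \<le> l \<bullet> x"
    by (auto simp: interior_Delta not_less)
  then have l: "l \<in> N" "l \<bullet> x = 1"
    using \<open>x \<in> F\<close> \<open>F \<subseteq> Delta N\<close> by (auto simp: Delta_def intro: antisym)
  have face: "facet N l face_of Delta N" using facet_facet_of[OF l(1)] by (simp add: facet_of_def)
  have "x \<in> facet N l" using l \<open>x \<in> F\<close> \<open>F \<subseteq> Delta N\<close> by (auto simp: facet_def)
  then have sub: "F \<subseteq> facet N l"
    using x by (intro subset_of_face_of[OF face \<open>F \<subseteq> Delta N\<close>]) auto
  have "F = facet N l"
  proof (rule ccontr)
    assume "F \<noteq> facet N l"
    moreover have "F face_of facet N l"
      using F(1) sub facet_subset by (rule face_of_subset)
    ultimately have "aff_dim F < aff_dim (facet N l)"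
      using face_of_imp_convex[OF face] by (intro face_of_aff_dim_lt)
    then show False using F(3) facet_facet_of[OF l(1)] by (simp add: facet_of_def)
  qed
  with l(1) show thesis by (rule that)
qed

lemma Delta_star_eq: "Delta_star N = interior (Delta N) \<union> (\<Union>l\<in>N. rel_interior (facet N l))"
proof -
  have "{F. F facet_of Delta N} = facet N ` N"
    using facet_of_Delta facet_facet_of by blast
  then show ?thesis by (simp add: Delta_star_def)
qed

lemma interior_subset_Delta_star: "interior (Delta N) \<subseteq> Delta_star N"
  by (auto simp: Delta_star_eq)

lemma zero_in_Delta_star: "0 \<in> Delta_star N"
  using zero_in_interior interior_subset_Delta_star by blast

text \<open>A point of the facet on no other facet hyperplane is relatively interior. The points to
  be excluded are described by \<open>(l' - l) \<bullet> x = 0\<close>, which on the hyperplane of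
  \<open>l\<close> means \<open>l' \<bullet> x = 1\<close> but is conical, so that nullity can be
  tested in the ambient space.\<close>

lemma AE_rel_interior_facet:
  assumes l: "l \<in> N"
  shows "AE y in hyperplane_lebesgue l. y \<in> facet N l \<longrightarrow> y \<in> rel_interior (facet N l)"
proof -
  have "AE y in hyperplane_lebesgue l. \<forall>l'\<in>N - {l}. y \<notin> {x. (l' - l) \<bullet> x = 0}"
  proof (rule AE_finite_allI)
    fix l' assume "l' \<in> N - {l}"
    let ?A = "{x. (l' - l) \<bullet> x = 0}"
    have A: "?A \<in> sets borel"
      using closed_hyperplane[of "l' - l" 0] by auto
    have "negligible ?A"
      using \<open>l' \<in> N - {l}\<close> by (intro negligible_hyperplane) auto
    then have "emeasure lborel ?A = 0"
      using A by (simp add: negligible_iff_emeasure0 emeasure_completion)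
    then have "emeasure lborel (?A \<inter> {x. l \<bullet> x > 0}) = 0"
      using A by (metis emeasure_mono inf_le1 le_zero_eq sets_lborel)
    then show "AE y in hyperplane_lebesgue l. y \<notin> ?A"
      by (subst hyperplane_lebesgue_cone_null_iff[OF normal_nonzero[OF l] A]) auto
  qed (use finite_N in simp)
  with AE_hyperplane_lebesgue[OF normal_nonzero[OF l]] show ?thesis
  proof eventually_elim
    case (elim y)
    show ?case
    proof
      assume y: "y \<in> facet N l"
      let ?T = "\<Inter>l'\<in>N - {l}. {x. l' \<bullet> x < 1}"
      have "open ?T" using finite_N by (intro open_INT ballI open_halfspace_lt) auto
      moreover have "y \<in> ?T"
        using y elim by (fastforce simp: facet_def Delta_def inner_diff_left less_le)
      moreover have "affine hull (facet N l) \<subseteq> {x. l \<bullet> x = 1}"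
        by (intro hull_minimal affine_hyperplane) (auto simp: facet_def)
      then have "?T \<inter> affine hull (facet N l) \<subseteq> facet N l"
        by (force simp: facet_def Delta_def intro: less_imp_le)
      ultimately show "y \<in> rel_interior (facet N l)"
        using y unfolding mem_rel_interior by blast
    qed
  qed
qed

text \<open>Both affine sets have dimension n - 1, since \<Delta> has full dimension.\<close>

lemma affine_hull_facet:
  assumes l: "l \<in> N"
  shows "affine hull (facet N l) = {x. l \<bullet> x = 1}"
proof (rule affine_dim_equal)
  show "affine hull (facet N l) \<subseteq> {x. l \<bullet> x = 1}"
    by (intro hull_minimal affine_hyperplane) (auto simp: facet_def)
  have "aff_dim (Delta N) = int CARD('n)"
    using zero_in_interior aff_dim_nonempty_interior[of "Delta N"] by auto
  then show "aff_dim (affine hull (facet N l)) = aff_dim {x. l \<bullet> x = 1}"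
    using facet_facet_of[OF l] normal_nonzero[OF l] by (simp add: facet_of_def aff_dim_affine_hull)
  show "affine hull (facet N l) \<noteq> {}"
    using facet_facet_of[OF l] by (simp add: facet_of_def)
qed (simp_all add: affine_hyperplane)

text \<open>The counterpart on a facet of \<open>interior_Delta_subset_closure_AE\<close>: a
  nonempty relatively open piece of a facet is not null, because the cone over it is open in the
  ambient space.\<close>

lemma rel_interior_facet_subset_closure_AE:
  assumes l: "l \<in> N" and Q: "AE y in hyperplane_lebesgue l. y \<in> facet N l \<longrightarrow> Q y"
  shows "rel_interior (facet N l) \<subseteq> closure {y \<in> rel_interior (facet N l). Q y}" (is "_ \<subseteq> closure ?Z")
proof (rule ccontr)
  assume "\<not> ?thesis"
  then obtain y0 where y0: "y0 \<in> rel_interior (facet N l)" "y0 \<notin> closure ?Z" by blast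
  obtain T where T: "open T" "y0 \<in> T" "T \<inter> {x. l \<bullet> x = 1} \<subseteq> facet N l"
    using y0(1) unfolding mem_rel_interior affine_hull_facet[OF l] by blast
  define W where "W = T - closure ?Z"
  have W: "open W" "y0 \<in> W" using T y0 by (auto simp: W_def)
  have ly0: "l \<bullet> y0 = 1" using y0(1) rel_interior_subset by (auto simp: facet_def)
  have nQ: "y \<in> facet N l \<and> \<not> Q y" if "y \<in> W" "l \<bullet> y = 1" for y
  proof -
    have "y \<in> rel_interior (facet N l)"
      unfolding mem_rel_interior affine_hull_facet[OF l] using T that by (auto simp: W_def)
    moreover from this have "y \<in> facet N l" using rel_interior_subset by blast
    moreover have "y \<notin> ?Z" using that(1) closure_subset[of ?Z] by (auto simp: W_def)
    ultimately show ?thesis by blast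
  qed
  \<comment> \<open>The cone over the points of \<open>W\<close> at height 1, as a preimage under
    radial projection to the hyperplane, which shows that it is open.\<close>
  define A where "A = {x. l \<bullet> x > 0} \<inter> (\<lambda>x. (1 / (l \<bullet> x)) *\<^sub>R x) -` W"
  have "open A"
    unfolding A_def using W(1)
    by (intro continuous_open_preimage) (auto intro!: continuous_intros open_Collect_less)
  have "AE y in hyperplane_lebesgue l. y \<notin> A"
    using Q AE_hyperplane_lebesgue[OF normal_nonzero[OF l]]
    by eventually_elim (use nQ in \<open>auto simp: A_def\<close>)
  then have "emeasure lborel (A \<inter> {x. l \<bullet> x > 0}) = 0"
    using \<open>open A\<close>
    by (subst (asm) hyperplane_lebesgue_cone_null_iff[OF normal_nonzero[OF l]])
       (auto simp: A_def zero_less_mult_iff)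
  moreover have "A \<inter> {x. l \<bullet> x > 0} = A" by (auto simp: A_def)
  ultimately have "negligible A"
    using \<open>open A\<close> by (simp add: negligible_iff_emeasure0 emeasure_completion)
  moreover have "y0 \<in> A" using W ly0 by (simp add: A_def)
  ultimately show False using \<open>open A\<close> open_not_negligible by blast
qed

text \<open>Along each ray \<open>v(t y) \<le> t v(y)\<close>, and \<open>\<integral>\<^sub>0\<^sup>1 t\<^sup>n\<^sup>-\<^sup>1 t dt = 1 / (n + 1)\<close>.\<close>
lemma convex_boundary_integral_ge:
  assumes v: "convex_on (Delta_star N) v" "\<And>x. x \<in> Delta_star N \<Longrightarrow> 0 \<le> v x" "v 0 = 0"
    and bd: "boundary_integrable N v"
  shows "set_integrable lebesgue (Delta N) v"
    and "(real CARD('n) + 1) * (LINT x:Delta N|lebesgue. v x) \<le> boundary_integral N v"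
proof -
  let ?n = "real CARD('n)" and ?k = "CARD('n) - 1"
  \<comment> \<open>\<open>v\<close> itself need not be Borel. Cut off to the interior it is, since
    convex functions are continuous there; the change is confined to the negligible
    frontier.\<close>
  define w where "w x = indicator (interior (Delta N)) x *\<^sub>R v x" for x
  have "convex_on (interior (Delta N)) v"
    using v(1) interior_subset_Delta_star by (rule convex_on_subset) (simp add: convex_Delta)
  then have "continuous_on (interior (Delta N)) v"
    by (intro convex_on_continuous) auto
  then have w[measurable]: "w \<in> borel_measurable borel"
    unfolding w_def by (intro borel_measurable_continuous_on_indicator) auto
  have w_nonneg: "0 \<le> w x" for x
    using v(2) interior_subset_Delta_star by (auto simp: w_def indicator_def)
  have v_int: "set_integrable (hyperplane_lebesgue l) (facet N l) v" if "l \<in> N" for l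
    using bd that by (simp add: boundary_integrable_def)
  have AE_v: "AE y in hyperplane_lebesgue l. 0 \<le> indicator (facet N l) y *\<^sub>R v y" if "l \<in> N" for l
    using AE_rel_interior_facet[OF that]
    by eventually_elim (use that v(2) in \<open>auto simp: indicator_def Delta_star_eq\<close>)
  let ?I = "\<lambda>l. LINT y:facet N l|hyperplane_lebesgue l. v y"
  have I_nonneg: "0 \<le> ?I l" if "l \<in> N" for l
    unfolding set_lebesgue_integral_def by (intro integral_nonneg_AE AE_v that)
  have ray: "(\<integral>\<^sup>+t. ennreal (t ^ ?k) * ennreal (w (t *\<^sub>R y)) * indicator {0<..1} t \<partial>lborel) \<le> ennreal (1 / (?n + 1) * v y)"
    if l: "l \<in> N" and y: "y \<in> rel_interior (facet N l)" for l y
  proof -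
    have yF: "y \<in> facet N l" using y rel_interior_subset by blast
    have yS: "y \<in> Delta_star N" using l y by (auto simp: Delta_star_eq)
    \<comment> \<open>Convexity between \<open>y\<close> and the origin, where \<open>v\<close>
      vanishes. If the point is not interior, \<open>w\<close> is 0 there and
      \<open>v y \<ge> 0\<close> suffices.\<close>
    have le: "w (t *\<^sub>R y) \<le> t * v y" if "0 < t" "t \<le> 1" for t
    proof (cases "t *\<^sub>R y \<in> interior (Delta N)")
      case True
      have "v (t *\<^sub>R y + (1 - t) *\<^sub>R 0) \<le> t * v y + (1 - t) * v 0"
        using v(1) yS zero_in_Delta_star that unfolding convex_on_def by force
      then show ?thesis using True v(3) by (simp add: w_def)
    qed (use that v(2)[OF yS] in \<open>simp add: w_def\<close>)
    have "(\<integral>\<^sup>+t. ennreal (t ^ ?k) * ennreal (w (t *\<^sub>R y)) * indicator {0<..1} t \<partial>lborel)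
        \<le> (\<integral>\<^sup>+t. ennreal (t ^ Suc ?k * v y) * indicator {0..1} t \<partial>lborel)"
    proof (rule nn_integral_mono)
      fix t :: real
      show "ennreal (t ^ ?k) * ennreal (w (t *\<^sub>R y)) * indicator {0<..1} t \<le> ennreal (t ^ Suc ?k * v y) * indicator {0..1} t"
      proof (cases "t \<in> {0<..1}")
        case True
        have "t ^ ?k * w (t *\<^sub>R y) \<le> t ^ ?k * (t * v y)"
          using le[of t] True by (intro mult_left_mono) auto
        also have "\<dots> = t ^ Suc ?k * v y" by (simp only: power_Suc mult_ac)
        finally have "ennreal (t ^ ?k * w (t *\<^sub>R y)) \<le> ennreal (t ^ Suc ?k * v y)"
          by (rule ennreal_leI)
        moreover have "ennreal (t ^ ?k) * ennreal (w (t *\<^sub>R y)) = ennreal (t ^ ?k * w (t *\<^sub>R y))"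
          using True w_nonneg by (simp add: ennreal_mult)
        ultimately show ?thesis using True by (simp del: power_Suc)
      qed simp
    qed
    also have "\<dots> = ennreal (1 / (real (Suc ?k) + 1) * v y)"
      using v(2)[OF yS] by (intro nn_integral_has_integral_lebesgue' has_integral_mult_left ray_integral_power) auto
    finally show ?thesis by simp
  qed
  have "(\<integral>\<^sup>+x. ennreal (w x) \<partial>lborel) = (\<integral>\<^sup>+x. ennreal (w x) * indicator (Delta N) x \<partial>lborel)"
    using interior_subset[of "Delta N"] by (intro nn_integral_cong) (auto simp: w_def indicator_def)
  also have "\<dots> = (\<Sum>l\<in>N. ennreal (1 / norm l) * (\<integral>\<^sup>+y. (\<integral>\<^sup>+t. ennreal (t ^ ?k) * ennreal (w (t *\<^sub>R y)) * indicator {0<..1} t \<partial>lborel)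
       * indicator (facet N l) y \<partial>hyperplane_lebesgue l))"
    by (rule nn_integral_Delta) measurable
  also have "\<dots> \<le> (\<Sum>l\<in>N. ennreal (1 / norm l) * (\<integral>\<^sup>+y. ennreal (1 / (?n + 1) * (indicator (facet N l) y *\<^sub>R v y)) \<partial>hyperplane_lebesgue l))"
  proof (intro sum_mono mult_left_mono nn_integral_mono_AE)
    fix l assume l: "l \<in> N"
    show "AE y in hyperplane_lebesgue l. (\<integral>\<^sup>+t. ennreal (t ^ ?k) * ennreal (w (t *\<^sub>R y)) * indicator {0<..1} t \<partial>lborel)
       * indicator (facet N l) y \<le> ennreal (1 / (?n + 1) * (indicator (facet N l) y *\<^sub>R v y))"
      using AE_rel_interior_facet[OF l]
      by eventually_elim (use ray[OF l] in \<open>auto simp: indicator_def\<close>)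
  qed simp
  also have "\<dots> = (\<Sum>l\<in>N. ennreal (1 / norm l) * ennreal (1 / (?n + 1) * ?I l))"
  proof (intro sum.cong refl arg_cong2[where f = times])
    fix l assume l: "l \<in> N"
    have "AE y in hyperplane_lebesgue l. 0 \<le> 1 / (?n + 1) * (indicator (facet N l) y *\<^sub>R v y)"
      using AE_v[OF l] by eventually_elim auto
    then show "(\<integral>\<^sup>+y. ennreal (1 / (?n + 1) * (indicator (facet N l) y *\<^sub>R v y)) \<partial>hyperplane_lebesgue l)
        = ennreal (1 / (?n + 1) * ?I l)"
      using v_int[OF l] unfolding set_integrable_def set_lebesgue_integral_def
      by (subst nn_integral_eq_integral) auto
  qed
  also have "\<dots> = (\<Sum>l\<in>N. ennreal (1 / norm l * (1 / (?n + 1) * ?I l)))"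
    using I_nonneg by (intro sum.cong refl) (simp only: ennreal_mult[symmetric] divide_nonneg_nonneg zero_le_one
        norm_ge_zero mult_nonneg_nonneg add_nonneg_nonneg of_nat_0_le_iff)
  also have "\<dots> = ennreal (\<Sum>l\<in>N. 1 / norm l * (1 / (?n + 1) * ?I l))"
    using I_nonneg by (intro sum_ennreal) auto
  also have "(\<Sum>l\<in>N. 1 / norm l * (1 / (?n + 1) * ?I l)) = boundary_integral N v / (?n + 1)"
    by (simp add: boundary_integral_def sum_divide_distrib)
  finally have le: "(\<integral>\<^sup>+x. ennreal (w x) \<partial>lborel) \<le> ennreal (boundary_integral N v / (?n + 1))" .
  \<comment> \<open>The finite bound by the boundary integral is what yields integrability over
    \<Delta>.\<close>
  then have w_int: "integrable lborel w"
    using w_nonneg by (auto simp: integrable_iff_bounded intro: le_less_trans)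
  have bd_nonneg: "0 \<le> boundary_integral N v"
    unfolding boundary_integral_def using I_nonneg by (intro sum_nonneg) auto
  have w_le: "(LINT x|lborel. w x) \<le> boundary_integral N v / (?n + 1)"
    using le w_int w_nonneg bd_nonneg by (simp add: nn_integral_eq_integral)
  have wD: "indicator (Delta N) x *\<^sub>R w x = w x" for x
    using interior_subset[of "Delta N"] by (auto simp: w_def indicator_def)
  have w_abs: "set_integrable lebesgue (Delta N) w"
    unfolding set_integrable_def wD using w_int by (subst integrable_completion) auto
  have spike: "v x = w x" if "x \<in> Delta N - frontier (Delta N)" for x
    using that closed_Delta by (auto simp: frontier_def w_def)
  show v_abs: "set_integrable lebesgue (Delta N) v"
    by (rule absolutely_integrable_spike[OF w_abs negligible_frontier_Delta spike])
  have "(LINT x:Delta N|lebesgue. v x) = (LINT x:Delta N|lebesgue. w x)"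
    using integral_spike[OF negligible_frontier_Delta spike]
    by (simp add: set_lebesgue_integral_eq_integral(2)[OF v_abs] set_lebesgue_integral_eq_integral(2)[OF w_abs])
  also have "\<dots> = (LINT x|lborel. w x)"
    unfolding set_lebesgue_integral_def wD by (rule integral_completion) simp
  finally show "(?n + 1) * (LINT x:Delta N|lebesgue. v x) \<le> boundary_integral N v"
    using w_le by (simp add: pos_le_divide_eq mult.commute)
qed


subsection \<open>Relative K-stability\<close>

text \<open>The constant function 1 is affine, so its value under the functional is 0; with average
  n the terms n Vol(\<Delta>) cancel.\<close>

lemma integral_extremal_potential: "(LINT x:Delta N|lebesgue. extremal_potential N x) = 0"
proof -
  obtain a c where \<theta>: "extremal_potential N = (\<lambda>x. a \<bullet> x + c)"
    using affine_extremal_potential by (auto simp: affine_linear_def)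
  have "affine_linear (\<lambda>_ :: real ^ 'n. 1)"
    unfolding affine_linear_def by (intro exI[of _ 0] exI[of _ 1]) simp
  from L_Delta_affine[OF this]
  have "boundary_integral N (\<lambda>_. 1) = (LINT x:Delta N|lebesgue. real CARD('n) + extremal_potential N x)"
    by (simp add: L_Delta_eq)
  also have "\<dots> = (LINT x:Delta N|lebesgue. real CARD('n)) + (LINT x:Delta N|lebesgue. extremal_potential N x)"
    unfolding \<theta> by (intro set_integral_add(2) set_integrable_Delta_continuous continuous_intros)
  finally show ?thesis
    using boundary_integrable_const_and_integral by (simp add: set_integral_Delta_const)
qed

text \<open>An affine function with an interior maximum is constant, and the constant 1 does not
  have mean zero. Strictness is what allows division by 1 - \<theta> in the case of
  equality.\<close>

lemma extremal_potential_less_1: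
  assumes le: "\<And>x. x \<in> Delta N \<Longrightarrow> extremal_potential N x \<le> 1" and x: "x \<in> interior (Delta N)"
  shows "extremal_potential N x < 1"
proof (rule ccontr)
  obtain a c where \<theta>: "extremal_potential N = (\<lambda>x. a \<bullet> x + c)"
    using affine_extremal_potential by (auto simp: affine_linear_def)
  assume "\<not> ?thesis"
  then have eq: "extremal_potential N x = 1"
    using le[of x] x interior_subset[of "Delta N"] by force
  have "a = 0"
  proof (rule ccontr)
    assume a: "a \<noteq> 0"
    have "interior (Delta N) \<subseteq> interior {y. a \<bullet> y \<le> 1 - c}"
      using le by (intro interior_mono) (auto simp: \<theta> algebra_simps)
    then have "a \<bullet> x < 1 - c" using x a by auto
    then show False using eq by (simp add: \<theta>)
  qed
  then have "extremal_potential N = (\<lambda>_. 1)" using eq by (simp add: \<theta>)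
  then show False
    using integral_extremal_potential measure_Delta_pos set_integral_Delta_const[of 1] by simp
qed

lemma set_integrable_affine_mult:
  assumes f: "affine_linear f" and v: "set_integrable lebesgue (Delta N) v"
  shows "set_integrable lebesgue (Delta N) (\<lambda>x. f x * v x)"
proof (rule absolutely_integrable_bounded_measurable_product[OF bilinear_times])
  obtain a c where "f = (\<lambda>x. a \<bullet> x + c)" using f by (auto simp: affine_linear_def)
  then have cont: "continuous_on UNIV f" by (auto intro!: continuous_intros)
  show "f \<in> borel_measurable (lebesgue_on (Delta N))"
    using continuous_on_subset[OF cont] by (intro continuous_imp_measurable_on_sets_lebesgue) auto
  obtain K where "\<And>x. x \<in> Delta N \<Longrightarrow> \<bar>f x\<bar> \<le> K"
    using continuous_bounded_on_Delta[OF cont] by blast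
  then show "bounded (f ` Delta N)" by (auto simp: bounded_iff)
qed (use v sets_Delta in auto)

text \<open>Equality makes two nonnegative terms vanish. The weighted integral gives
  \<open>v = 0\<close> on the interior; the other term then makes the boundary integral zero, which
  settles the facets, where \<open>v\<close> could otherwise jump up.\<close>

lemma L_Delta_convex_normalized:
  assumes v: "convex_on (Delta_star N) v" "\<And>x. x \<in> Delta_star N \<Longrightarrow> 0 \<le> v x" "v 0 = 0"
    and bd: "boundary_integrable N v"
    and le: "\<And>x. x \<in> Delta N \<Longrightarrow> extremal_potential N x \<le> 1"
  shows "0 \<le> L_Delta N v" and "L_Delta N v = 0 \<longleftrightarrow> (\<forall>x\<in>Delta_star N. v x = 0)"
proof -
  let ?n = "real CARD('n)" and ?\<theta> = "extremal_potential N"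
  have int_v: "set_integrable lebesgue (Delta N) v"
    and ge: "(?n + 1) * (LINT x:Delta N|lebesgue. v x) \<le> boundary_integral N v"
    using convex_boundary_integral_ge[OF v bd] by blast+
  have int_\<theta>v: "set_integrable lebesgue (Delta N) (\<lambda>x. ?\<theta> x * v x)"
    by (rule set_integrable_affine_mult[OF affine_extremal_potential int_v])
  have int_nv: "set_integrable lebesgue (Delta N) (\<lambda>x. k * v x)" for k
    using int_v by simp
  have int_1v: "set_integrable lebesgue (Delta N) (\<lambda>x. (1 - ?\<theta> x) * v x)"
    using set_integral_diff(1)[OF int_v int_\<theta>v] by (simp add: left_diff_distrib)
  \<comment> \<open>This rests on n + \<theta> = (n + 1) - (1 - \<theta>).\<close>
  have L: "L_Delta N v = (boundary_integral N v - (?n + 1) * (LINT x:Delta N|lebesgue. v x))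
      + (LINT x:Delta N|lebesgue. (1 - ?\<theta> x) * v x)"
    using set_integral_add(2)[OF int_nv[of ?n] int_\<theta>v] set_integral_diff(2)[OF int_v int_\<theta>v]
    unfolding L_Delta_eq by (simp add: left_diff_distrib distrib_right)
  have AE_int: "AE x in lebesgue. x \<in> Delta N \<longrightarrow> x \<in> interior (Delta N)"
    using AE_not_in[OF negligible_frontier_Delta[unfolded negligible_iff_null_sets]]
    by eventually_elim (use closed_Delta in \<open>auto simp: frontier_def\<close>)
  have AE_nonneg: "AE x in lebesgue. 0 \<le> indicator (Delta N) x *\<^sub>R ((1 - ?\<theta> x) * v x)"
    using AE_int by eventually_elim
      (use le v(2) interior_subset_Delta_star in \<open>auto simp: indicator_def intro!: mult_nonneg_nonneg\<close>)
  have nonneg: "0 \<le> (LINT x:Delta N|lebesgue. (1 - ?\<theta> x) * v x)"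
    unfolding set_lebesgue_integral_def by (rule integral_nonneg_AE[OF AE_nonneg])
  show "0 \<le> L_Delta N v" using L ge nonneg by linarith
  have AE_v: "AE y in hyperplane_lebesgue l. 0 \<le> indicator (facet N l) y *\<^sub>R v y" if "l \<in> N" for l
    using AE_rel_interior_facet[OF that]
    by eventually_elim (use that v(2) in \<open>auto simp: indicator_def Delta_star_eq\<close>)
  show "L_Delta N v = 0 \<longleftrightarrow> (\<forall>x\<in>Delta_star N. v x = 0)"
  proof
    assume zero: "\<forall>x\<in>Delta_star N. v x = 0"
    have AE0: "AE x in lebesgue. x \<in> Delta N \<longrightarrow> v x = 0"
      using AE_int by eventually_elim (use zero interior_subset_Delta_star in blast)
    have "(LINT x:Delta N|lebesgue. (?n + ?\<theta> x) * v x) = 0"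
      unfolding set_lebesgue_integral_def
      by (rule integral_eq_zero_AE, use AE0 in eventually_elim) (auto simp: indicator_def)
    moreover have "(LINT y:facet N l|hyperplane_lebesgue l. v y) = 0" if "l \<in> N" for l
      unfolding set_lebesgue_integral_def
      by (rule integral_eq_zero_AE, use AE_rel_interior_facet[OF that] in eventually_elim)
         (use zero that in \<open>auto simp: indicator_def Delta_star_eq\<close>)
    then have "boundary_integral N v = 0" by (simp add: boundary_integral_def)
    ultimately show "L_Delta N v = 0" by (simp add: L_Delta_eq)
  next
    assume "L_Delta N v = 0"
    then have "(LINT x:Delta N|lebesgue. (1 - ?\<theta> x) * v x) = 0"
      and bd_eq: "boundary_integral N v = (?n + 1) * (LINT x:Delta N|lebesgue. v x)"
      using L ge nonneg by linarith+
    then have "AE x in lebesgue. indicator (Delta N) x *\<^sub>R ((1 - ?\<theta> x) * v x) = 0"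
      using int_1v AE_nonneg unfolding set_lebesgue_integral_def set_integrable_def
      by (subst (asm) integral_nonneg_eq_0_iff_AE) auto
    with AE_int have AE0: "AE x in lebesgue. x \<in> Delta N \<longrightarrow> v x = 0"
    proof eventually_elim
      case (elim x)
      then show ?case using extremal_potential_less_1[OF le, of x] by (auto simp: indicator_def)
    qed
    have "interior (Delta N) \<subseteq> {x. v x = 0}"
    proof -
      let ?Z = "{x \<in> interior (Delta N). v x = 0}"
      have "convex ?Z"
        using v interior_subset_Delta_star convex_interior[OF convex_Delta]
        by (intro convex_zero_set[of "Delta_star N"]) auto
      \<comment> \<open>A convex set that is dense in an open set contains it.\<close>
      then have "interior ?Z = interior (closure ?Z)" by (simp add: convex_interior_closure)
      then show ?thesis
        using interior_Delta_subset_closure_AE[OF AE0] interior_maximal[of "interior (Delta N)" "closure ?Z"]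
          interior_subset[of ?Z] by auto
    qed
    moreover have "rel_interior (facet N l) \<subseteq> {x. v x = 0}" if l: "l \<in> N" for l
    proof -
      let ?Z = "{y \<in> rel_interior (facet N l). v y = 0}"
      have convF: "convex (facet N l)"
        using facet_facet_of[OF l] facet_of_imp_face_of face_of_imp_convex by blast
      \<comment> \<open>By \<open>bd_eq\<close> the nonnegative facet integrals now add up to zero,
        so each of them vanishes.\<close>
      have "(LINT x:Delta N|lebesgue. v x) = 0"
        unfolding set_lebesgue_integral_def
        by (rule integral_eq_zero_AE, use AE0 in eventually_elim) (auto simp: indicator_def)
      then have "(\<Sum>l\<in>N. 1 / norm l * (LINT y:facet N l|hyperplane_lebesgue l. v y)) = 0"
        using bd_eq by (simp add: boundary_integral_def)
      moreover have "0 \<le> 1 / norm l' * (LINT y:facet N l'|hyperplane_lebesgue l'. v y)" if "l' \<in> N" for l'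
        unfolding set_lebesgue_integral_def
        by (intro mult_nonneg_nonneg integral_nonneg_AE AE_v that) simp
      ultimately have "1 / norm l * (LINT y:facet N l|hyperplane_lebesgue l. v y) = 0"
        using finite_N l by (subst (asm) sum_nonneg_eq_0_iff) auto
      then have "(LINT y:facet N l|hyperplane_lebesgue l. v y) = 0"
        using normal_nonzero[OF l] by simp
      then have "AE y in hyperplane_lebesgue l. indicator (facet N l) y *\<^sub>R v y = 0"
        using bd l AE_v[OF l] unfolding set_lebesgue_integral_def boundary_integrable_def set_integrable_def
        by (subst (asm) integral_nonneg_eq_0_iff_AE) auto
      then have "AE y in hyperplane_lebesgue l. y \<in> facet N l \<longrightarrow> v y = 0"
        by eventually_elim (auto simp: indicator_def)
      then have sub: "rel_interior (facet N l) \<subseteq> closure ?Z"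
        by (rule rel_interior_facet_subset_closure_AE[OF l])
      \<comment> \<open>Convex sets with the same closure have the same relative interior, so
        density of the zero set again becomes containment.\<close>
      then have "closure (rel_interior (facet N l)) = closure ?Z"
        by (intro antisym closure_minimal closure_mono) auto
      then have "rel_interior (facet N l) = rel_interior (closure ?Z)"
        using convF closed_facet by (metis convex_closure_rel_interior convex_rel_interior_closure)
      also have "\<dots> = rel_interior ?Z"
      proof (rule convex_rel_interior_closure)
        show "convex ?Z"
          using v l convex_rel_interior[OF convF]
          by (intro convex_zero_set[of "Delta_star N"]) (auto simp: Delta_star_eq)
      qed
      also have "\<dots> \<subseteq> ?Z" by (rule rel_interior_subset)
      finally show ?thesis by blast
    qed
    ultimately show "\<forall>x\<in>Delta_star N. v x = 0"
      unfolding Delta_star_eq by blast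
  qed
qed

text \<open>\<open>u - f\<close> vanishes at the origin, as the comparison along rays requires, and
  subtracting \<open>f\<close> leaves the functional unchanged. Keeping \<open>f\<close> arbitrary
  lets it be a supporting function of \<open>u\<close> or, when \<open>u\<close> is affine on
  \<Delta>*, that affine function itself.\<close>

lemma L_Delta_affine_minorant:
  assumes u: "u \<in> C1 N" and f: "affine_linear f"
    and ge: "\<And>x. x \<in> Delta_star N \<Longrightarrow> f x \<le> u x" "f 0 = u 0"
    and le: "\<And>x. x \<in> Delta N \<Longrightarrow> extremal_potential N x \<le> 1"
  shows "0 \<le> L_Delta N u" and "L_Delta N u = 0 \<longleftrightarrow> (\<forall>x\<in>Delta_star N. u x = f x)"
proof -
  let ?v = "\<lambda>x. u x - f x" and ?w = "\<lambda>x. real CARD('n) + extremal_potential N x"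
  obtain a c where fa: "f = (\<lambda>x. a \<bullet> x + c)" using f by (auto simp: affine_linear_def)
  have v: "convex_on (Delta_star N) ?v" "\<And>x. x \<in> Delta_star N \<Longrightarrow> 0 \<le> ?v x" "?v 0 = 0"
  proof -
    show "convex_on (Delta_star N) ?v"
      unfolding convex_on_def
    proof (intro conjI ballI allI impI)
      have conv: "convex_on (Delta_star N) u" using u by (simp add: C1_def)
      then show "convex (Delta_star N)" by (simp add: convex_on_def)
      fix x y and s t :: real
      assume xy: "x \<in> Delta_star N" "y \<in> Delta_star N" and st: "0 \<le> s" "0 \<le> t" "s + t = 1"
      have "c = s * c + t * c" using st(3) by (simp flip: distrib_right)
      then have "f (s *\<^sub>R x + t *\<^sub>R y) = s * f x + t * f y"
        by (simp add: fa inner_add_right distrib_left)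
      moreover have "u (s *\<^sub>R x + t *\<^sub>R y) \<le> s * u x + t * u y"
        using conv xy st unfolding convex_on_def by blast
      ultimately show "u (s *\<^sub>R x + t *\<^sub>R y) - f (s *\<^sub>R x + t *\<^sub>R y) \<le> s * (u x - f x) + t * (u y - f y)"
        by (simp add: right_diff_distrib)
    qed
  qed (use ge in auto)
  have bd: "boundary_integrable N u" using u by (simp add: C1_def)
  have bdv: "boundary_integrable N ?v"
    using boundary_integral_add(1)[OF bd boundary_integral_cmult(1)[OF boundary_integrable_affine[OF f], of "-1"]] by simp
  have aw: "affine_linear ?w"
  proof -
    obtain b d where "extremal_potential N = (\<lambda>x. b \<bullet> x + d)"
      using affine_extremal_potential by (auto simp: affine_linear_def)
    then have "?w = (\<lambda>x. b \<bullet> x + (real CARD('n) + d))" by auto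
    then show ?thesis unfolding affine_linear_def by blast
  qed
  have "set_integrable lebesgue (Delta N) f"
    unfolding fa by (intro set_integrable_Delta_continuous continuous_intros)
  then have "(LINT x:Delta N|lebesgue. ?w x * ?v x + ?w x * f x) = (LINT x:Delta N|lebesgue. ?w x * ?v x) + (LINT x:Delta N|lebesgue. ?w x * f x)"
    by (intro set_integral_add(2) set_integrable_affine_mult[OF aw] convex_boundary_integral_ge(1)[OF v bdv])
  moreover have "boundary_integral N (\<lambda>x. ?v x + f x) = boundary_integral N ?v + boundary_integral N f"
    by (rule boundary_integral_add(2)[OF bdv boundary_integrable_affine[OF f]])
  ultimately have "L_Delta N u = L_Delta N ?v + L_Delta N f"
    unfolding L_Delta_eq by (simp flip: distrib_left)
  then have "L_Delta N u = L_Delta N ?v" using L_Delta_affine[OF f] by simp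
  then show "0 \<le> L_Delta N u" and "L_Delta N u = 0 \<longleftrightarrow> (\<forall>x\<in>Delta_star N. u x = f x)"
    using L_Delta_convex_normalized[OF v bdv le] by simp_all
qed

lemma relatively_strongly_K_stable:
  assumes le: "\<And>x. x \<in> Delta N \<Longrightarrow> extremal_potential N x \<le> 1"
  shows "relatively_strongly_K_stable N"
  unfolding relatively_strongly_K_stable_def
proof (intro ballI conjI)
  fix u assume u: "u \<in> C1 N"
  then have conv: "convex_on (Delta_star N) u" by (simp add: C1_def)
  have "0 \<in> interior (Delta_star N)"
    using zero_in_interior interior_maximal[OF interior_subset_Delta_star open_interior] by blast
  then obtain a where a: "\<And>x. x \<in> Delta_star N \<Longrightarrow> u 0 + a \<bullet> (x - 0) \<le> u x"
    using convex_on_affine_minorant[OF conv] by blast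
  let ?f = "\<lambda>x. a \<bullet> x + u 0"
  have f: "affine_linear ?f" by (auto simp: affine_linear_def)
  have f_le: "\<And>x. x \<in> Delta_star N \<Longrightarrow> ?f x \<le> u x" and f0: "?f 0 = u 0"
    using a by (simp_all add: add.commute)
  show "0 \<le> L_Delta N u"
    by (rule L_Delta_affine_minorant(1)[OF u f f_le f0 le])
  show "L_Delta N u = 0 \<longleftrightarrow> (\<exists>f. affine_linear f \<and> (\<forall>x\<in>Delta_star N. u x = f x))"
  proof
    assume "L_Delta N u = 0"
    then show "\<exists>f. affine_linear f \<and> (\<forall>x\<in>Delta_star N. u x = f x)"
      using L_Delta_affine_minorant(2)[OF u f f_le f0 le] f by blast
  next
    assume "\<exists>f. affine_linear f \<and> (\<forall>x\<in>Delta_star N. u x = f x)"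
    then obtain g where g: "affine_linear g" "\<And>x. x \<in> Delta_star N \<Longrightarrow> u x = g x" by blast
    \<comment> \<open>Here \<open>g\<close> coincides with \<open>u\<close> on \<Delta>*, hence is
      itself a minorant touching at the origin.\<close>
    then show "L_Delta N u = 0"
      using L_Delta_affine_minorant(2)[OF u g(1) _ _ le] zero_in_Delta_star by simp
  qed
qed

end

section \<open>Application to moment polytopes of toric Fano manifolds\<close>

lemma fano_moment_polytope_at_unit_distance:
  assumes "fano_moment_polytope N"
  shows "polytope_at_unit_distance N"
proof
  obtain V where "finite V" "Delta N = convex hull V"
    using assms by (auto simp: fano_moment_polytope_def)
  then show "bounded (Delta N)"
    by (simp add: bounded_convex_hull finite_imp_bounded)
qed (use assms in \<open>auto simp: fano_moment_polytope_def\<close>)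

theorem theorem1p4:
  fixes N :: "(real ^ 'n) set" and a :: "real ^ 'n" and c :: real
  assumes "fano_moment_polytope N"
    and "extremal_potential N = (\<lambda>x. (\<Sum>i\<in>UNIV. a $ i * x $ i) + c)"
  shows "(interior (Delta_minus N) = {} \<longleftrightarrow> (\<forall>x\<in>Delta N. extremal_potential N x \<le> 1)) \<and>
    (interior (Delta_minus N) = {} \<longrightarrow> relatively_strongly_K_stable N) \<and>
    (interior (Delta_minus N) \<noteq> {} \<and>
       1 - c < (LINT x:Delta_minus N|lebesgue. (1 - extremal_potential N x)\<^sup>2)
                 / measure lebesgue (Delta_minus N)
     \<longrightarrow> (\<exists>u. simple_piecewise_linear u \<and> L_Delta N u < 0))"
proof -
  interpret polytope_at_unit_distance N
    by (rule fano_moment_polytope_at_unit_distance[OF assms(1)])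
  have \<theta>: "extremal_potential N = (\<lambda>x. a \<bullet> x + c)"
    using assms(2) by (simp add: inner_vec_def)
  show ?thesis
    using interior_Delta_minus_empty_iff[OF \<theta>] relatively_strongly_K_stable exists_destabilizing[OF \<theta>]
    by blast
qed

end
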